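(* A function $\chi: S(2^\infty)\to\mathbb{C}$ is an indecomposable character if and only if there exists $\alpha\in\mathbb{Z}_+\cup\{\infty\}$ (where $\mathbb{Z}_+=\{0,1,2,\dots\}$) such that $\chi(s)=\mu(Fix(s))^\alpha$ for all $s\in S(2^\infty)$.
   Context: Let $X=\prod_{1}^\infty\{0,1\}$ be the space of infinite $0,1$-sequences, and $\mu=\nu^{\otimes\infty}$ the product measure on $X$ with $\nu(\{0\})=\nu(\{1\})=1/2$. Let $X_n$ be the set of $0,1$-sequences of length $n$, and $S(2^n)$ the group of all bijections $X_n\to X_n$. $S(2^n)$ acts on $X$ by $s((x,a))=(s(x),a)$ for $x\in X_n$, $a\in X$; via this action $S(2^n)$ is a subgroup of $S(2^{n+1})$, and $S(2^\infty)=\bigcup_{n} S(2^n)$. For a bijection $s$ of $X$, $Fix(s)=\{x\in X: s(x)=x\}$. A character on a group $G$ is a function $\chi:G\to\mathbb{C}$ with $\chi(g_1g_2)=\chi(g_2g_1)$ for all $g_1,g_2$, such that the matrix $(\chi(g_ig_j^{-1}))_{i,j=1}^n$ is positive semidefinite for all $n$ and $g_1,\dots,g_n\in G$, and $\chi(e)=1$. A character is indecomposable if it cannot be written as $\alpha\chi_1+(1-\alpha)\chi_2$ with $0<\alpha<1$ and $\chi_1\neq\chi_2$ characters. Conventions: $0^0=1$, $x^\infty=0$ for $x\in[0,1)$, and $1^\infty=1$. *)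

theory Defs
  imports "HOL-Probability.Probability"
begin

type_synonym seq = "nat \<Rightarrow> bool"

definition mu :: "seq measure" where
  "mu = (\<Pi>\<^sub>M i\<in>(UNIV::nat set). measure_pmf (bernoulli_pmf (1/2)))"

text \<open>The action of a permutation sigma of X_n (length-n 0/1 lists) on X:
  s((x,a)) = (sigma(x), a).\<close>
definition act :: "nat \<Rightarrow> (bool list \<Rightarrow> bool list) \<Rightarrow> seq \<Rightarrow> seq" where
  "act n \<sigma> x = (\<lambda>i. if i < n then \<sigma> (map x [0..<n]) ! i else x i)"

definition S2 :: "nat \<Rightarrow> (seq \<Rightarrow> seq) set" where
  "S2 n = {act n \<sigma> | \<sigma>. \<sigma> permutes {xs. length xs = n}}"

definition S2inf :: "(seq \<Rightarrow> seq) set" where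
  "S2inf = (\<Union>n. S2 n)"

definition Fix :: "(seq \<Rightarrow> seq) \<Rightarrow> seq set" where
  "Fix s = {x. s x = x}"

definition is_character :: "((seq \<Rightarrow> seq) \<Rightarrow> complex) \<Rightarrow> bool" where
  "is_character chi \<longleftrightarrow>
     (\<forall>g1\<in>S2inf. \<forall>g2\<in>S2inf. chi (g1 \<circ> g2) = chi (g2 \<circ> g1)) \<and>
     (\<forall>(n::nat) (g::nat \<Rightarrow> seq \<Rightarrow> seq) (c::nat \<Rightarrow> complex).
        (\<forall>i<n. g i \<in> S2inf) \<longrightarrow>
        (let q = (\<Sum>i<n. \<Sum>j<n. cnj (c i) * chi (g i \<circ> inv (g j)) * c j)
         in Im q = 0 \<and> Re q \<ge> 0)) \<and>
     chi id = 1"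

definition is_indecomposable_character :: "((seq \<Rightarrow> seq) \<Rightarrow> complex) \<Rightarrow> bool" where
  "is_indecomposable_character chi \<longleftrightarrow> is_character chi \<and>
     \<not> (\<exists>(a::real) chi1 chi2. 0 < a \<and> a < 1 \<and> is_character chi1 \<and> is_character chi2 \<and>
          (\<exists>g\<in>S2inf. chi1 g \<noteq> chi2 g) \<and>
          (\<forall>g\<in>S2inf. chi g = of_real a * chi1 g + of_real (1 - a) * chi2 g))"

text \<open>x^alpha for alpha in Z_+ \<union> {\<infinity>}, with 0^0 = 1, x^\<infinity> = 0 for x<1, 1^\<infinity> = 1.\<close>
definition epow :: "real \<Rightarrow> enat \<Rightarrow> real" where
  "epow x \<alpha> = (case \<alpha> of enat k \<Rightarrow> x ^ k | \<infinity> \<Rightarrow> (if x = 1 then 1 else 0))"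

end

theory Submission
  imports Defs
begin

text \<open>
  Two mechanisms drive the proof. First, a family \<^term>\<open>u k\<close> in the group whose mutual values
  \<^term>\<open>chi (u k \<circ> inv (u l))\<close> (for distinct indices) are constant is, in the positive form defined by a
  character, asymptotically a single vector; applied to bit flips of far coordinates this shows that
  every character depends on \<^term>\<open>g\<close> only through the measure of its fixed point set, so it is given by
  a function \<open>profile\<close> on dyadic rationals. Far flips on clopen sets behave like commuting projections
  \<open>P\<^sub>A\<close> with \<open>P\<^sub>A P\<^sub>B = P\<^sub>A\<^sub>\<inter>\<^sub>B\<close>, hence all iterated differences of
  \<open>profile\<close> are nonnegative. Second, for an involution \<open>h\<close> moved to far coordinates, \<open>(1 \<plusminus> h) / 2\<close> are
  projections commuting with everything in sight, so they split a character; for an indecomposable one this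
  makes \<open>profile\<close> multiplicative. A multiplicative function with nonnegative differences is a power
  with exponent a natural number or infinity. Conversely the powers are positive definite by the Schur
  product argument, and they are extreme because averages of far copies of \<open>h\<close> converge in norm
  to the scalar \<open>chi h\<close>.
\<close>

section \<open>Cylinder sets and the groups \<open>S(2^n)\<close>\<close>

text \<open>No Hilbert space is built. Statements about limits of vectors or projections become
  inequalities for the positive form at finitely many elements: \<open>L\<close> far copies are used
  and an Archimedean argument lets \<open>L\<close> grow. The obstacle in the first half is cycle
  type: elements whose fixed point sets have equal measure are in general not conjugate, so
  centrality alone cannot identify their values. Far coordinates are what a finite symmetric group
  lacks: an element moved beyond level \<open>N\<close> commutes with \<open>S2 N\<close>, and its
  fixed point set is independent of the fixed point sets there, so composition multiplies measures.
  This is also where products of arguments of \<open>profile\<close> come from. A non-integer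
  exponent \<beta> is excluded because the iterated differences of its power function carry the sign
  of \<beta> (\<beta> - 1) (\<beta> - 2) ..., which turns negative once exactly one factor is
  negative.\<close>

definition cyl :: "nat \<Rightarrow> seq set \<Rightarrow> bool" where
  "cyl n C \<longleftrightarrow> (\<forall>x y. (\<forall>i<n. x i = y i) \<longrightarrow> (x \<in> C \<longleftrightarrow> y \<in> C))"

definition trunc :: "nat \<Rightarrow> seq \<Rightarrow> seq" where
  "trunc n x = (\<lambda>i. i < n \<and> x i)"

text \<open>\<open>X\<^sub>n\<close> is modelled by the sequences that vanish from position \<open>n\<close> on.\<close>

definition words :: "nat \<Rightarrow> seq set" where
  "words n = {x. \<forall>i\<ge>n. \<not> x i}"

lemma words_nth: "x \<in> words n \<Longrightarrow> x i \<Longrightarrow> i < n"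
  unfolding words_def by (rule ccontr) auto

lemma cylD: "cyl n C \<Longrightarrow> (\<And>i. i < n \<Longrightarrow> x i = y i) \<Longrightarrow> x \<in> C \<longleftrightarrow> y \<in> C"
  unfolding cyl_def by blast

lemma cyl_Un: "cyl n A \<Longrightarrow> cyl n B \<Longrightarrow> cyl n (A \<union> B)"
  and cyl_Int: "cyl n A \<Longrightarrow> cyl n B \<Longrightarrow> cyl n (A \<inter> B)"
  and cyl_Compl: "cyl n A \<Longrightarrow> cyl n (- A)"
  unfolding cyl_def by (blast, blast, blast)

lemma cyl_trunc_vimage: "cyl n (trunc n -` S)"
proof -
  have "trunc n x = trunc n y" if "\<forall>i<n. x i = y i" for x y
    using that by (auto simp: trunc_def)
  then show ?thesis unfolding cyl_def vimage_eq by metis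
qed

lemma trunc_in_words [simp]: "trunc n x \<in> words n"
  by (auto simp: trunc_def words_def)

lemma trunc_words: "x \<in> words n \<Longrightarrow> trunc n x = x"
  unfolding trunc_def by (rule ext) (blast intro: words_nth)

lemma trunc_nth: "i < n \<Longrightarrow> trunc n x i = x i"
  by (simp add: trunc_def)

lemma cyl_trunc_iff: "cyl n C \<Longrightarrow> trunc n x \<in> C \<longleftrightarrow> x \<in> C"
  by (rule cylD) (auto simp: trunc_def)

lemma bij_betw_words_Pow: "bij_betw Collect (words n) (Pow {..<n})"
  by (rule bij_betw_byWitness[where f' = "\<lambda>S x. x \<in> S"]) (auto simp: words_nth, auto simp: words_def)

lemma finite_words [simp]: "finite (words n)"
  using bij_betw_finite[OF bij_betw_words_Pow[of n]] by simp

lemma card_words: "card (words n) = 2 ^ n"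
  using bij_betw_same_card[OF bij_betw_words_Pow[of n]] by (simp add: card_Pow)

text \<open>Removes lists and \<open>act\<close> from all later arguments. In the converse direction
  \<open>\<sigma>\<close> reads off the action of \<open>g\<close> on words padded with
  \<open>False\<close>; as there are finitely many words, injectivity already gives a
  permutation.\<close>

lemma S2_iff:
  "g \<in> S2 n \<longleftrightarrow> bij g \<and> (\<forall>x i. n \<le> i \<longrightarrow> g x i = x i) \<and>
     (\<forall>x y. (\<forall>i<n. x i = y i) \<longrightarrow> (\<forall>i<n. g x i = g y i))" (is "_ \<longleftrightarrow> ?R")
proof
  assume "g \<in> S2 n"
  then obtain \<sigma> where g: "g = act n \<sigma>" and p: "\<sigma> permutes {xs. length xs = n}"
    unfolding S2_def by blast
  have len: "length (\<sigma> xs) = n" "length (inv \<sigma> xs) = n" if "length xs = n" for xs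
    using permutes_in_image[OF p, of xs] permutes_in_image[OF permutes_inv[OF p], of xs] that by auto
  have m: "map (act n \<rho> x) [0..<n] = \<rho> (map x [0..<n])" if "length (\<rho> (map x [0..<n])) = n" for \<rho> x
    using that by (intro nth_equalityI) (auto simp: act_def)
  have 1: "act n (inv \<sigma>) (act n \<sigma> x) = x" for x
    using m[of \<sigma> x] len[of "map x [0..<n]"] permutes_inverses(2)[OF p]
    unfolding act_def[of n "inv \<sigma>"] by (auto simp: fun_eq_iff) (auto simp: act_def)
  have 2: "act n \<sigma> (act n (inv \<sigma>) x) = x" for x
    using m[of "inv \<sigma>" x] len[of "map x [0..<n]"] permutes_inverses(1)[OF p]
    unfolding act_def[of n "\<sigma>"] by (auto simp: fun_eq_iff) (auto simp: act_def)
  have "bij g" unfolding g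
    by (rule o_bij[where g = "act n (inv \<sigma>)"]) (auto simp: 1 2)
  moreover have "act n \<sigma> x i = act n \<sigma> y i" if "\<forall>i<n. x i = y i" "i < n" for x y i
  proof -
    have "map x [0..<n] = map y [0..<n]" using that by auto
    with \<open>i < n\<close> show ?thesis unfolding act_def by (simp del: map_eq_conv)
  qed
  ultimately show ?R
    unfolding g by (auto simp: act_def)
next
  assume R: ?R
  define e :: "bool list \<Rightarrow> seq" where "e xs = (\<lambda>i. i < n \<and> xs ! i)" for xs
  define \<sigma> where "\<sigma> xs = (if length xs = n then map (g (e xs)) [0..<n] else xs)" for xs
  have "g = act n \<sigma>"
  proof (intro ext)
    fix x i
    have "g x i = g (e (map x [0..<n])) i" if "i < n"
      using R that by (auto simp: e_def)
    then show "g x i = act n \<sigma> x i"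
      using R by (auto simp: act_def \<sigma>_def)
  qed
  moreover have "\<sigma> permutes {xs. length xs = n}"
  proof (rule bij_imp_permutes)
    have fin: "finite {xs :: bool list. length xs = n}"
      using finite_lists_length_eq[of "UNIV :: bool set" n] by simp
    have "inj_on \<sigma> {xs. length xs = n}"
    proof (rule inj_onI)
      fix xs ys assume l: "xs \<in> {xs. length xs = n}" "ys \<in> {xs. length xs = n}" and eq: "\<sigma> xs = \<sigma> ys"
      have "g (e xs) i = g (e ys) i" for i
      proof (cases "i < n")
        case True
        with eq l show ?thesis by (auto simp: \<sigma>_def)
      next
        case False
        with R show ?thesis by (auto simp: e_def)
      qed
      then have "g (e xs) = g (e ys)" by blast
      then have "e xs = e ys" using R bij_is_inj injD by metis
      then have "xs ! i = ys ! i" if "i < n" for i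
        using that unfolding e_def by metis
      with l show "xs = ys" by (intro nth_equalityI) auto
    qed
    moreover have "\<sigma> ` {xs. length xs = n} \<subseteq> {xs. length xs = n}" by (auto simp: \<sigma>_def)
    ultimately show "bij_betw \<sigma> {xs. length xs = n} {xs. length xs = n}"
      unfolding bij_betw_def using endo_inj_surj[OF fin, of \<sigma>] by blast
  qed (auto simp: \<sigma>_def)
  ultimately show "g \<in> S2 n" unfolding S2_def by blast
qed

lemma S2_bij: "g \<in> S2 n \<Longrightarrow> bij g"
  and S2_above: "g \<in> S2 n \<Longrightarrow> n \<le> i \<Longrightarrow> g x i = x i"
  and S2_below: "g \<in> S2 n \<Longrightarrow> (\<And>i. i < n \<Longrightarrow> x i = y i) \<Longrightarrow> i < n \<Longrightarrow> g x i = g y i"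
  by (simp_all add: S2_iff)

lemma S2I:
  assumes "\<And>x. h (g x) = x" "\<And>x. g (h x) = x"
    and "\<And>x i. n \<le> i \<Longrightarrow> g x i = x i"
    and "\<And>x y i. (\<And>i. i < n \<Longrightarrow> x i = y i) \<Longrightarrow> i < n \<Longrightarrow> g x i = g y i"
  shows "g \<in> S2 n"
proof -
  have "bij g" by (rule o_bij[where g = h]) (simp_all add: fun_eq_iff assms(1,2))
  then show ?thesis unfolding S2_iff using assms(3,4) by blast
qed

lemma S2_agree:
  assumes "g \<in> S2 n" "n \<le> m" "\<And>i. i < m \<Longrightarrow> x i = y i" "i < m"
  shows "g x i = g y i"
proof (cases "i < n")
  case True
  have "x j = y j" if "j < n" for j using assms(2) that by (intro assms(3)) simp
  then show ?thesis by (rule S2_below[OF assms(1) _ True])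
next
  case False
  then have "g x i = x i" "g y i = y i" by (simp_all add: S2_above[OF assms(1)])
  then show ?thesis using assms(3)[OF assms(4)] by simp
qed

lemma S2_mono: assumes "g \<in> S2 n" "n \<le> m" shows "g \<in> S2 m"
  unfolding S2_iff[of g m]
proof (intro conjI allI impI)
  show "bij g" by (rule S2_bij[OF assms(1)])
  show "g x i = x i" if "m \<le> i" for x i using S2_above[OF assms(1)] assms(2) that by simp
  show "g x i = g y i" if "\<forall>i<m. x i = y i" "i < m" for x y i
    using that by (intro S2_agree[OF assms]) auto
qed

lemma S2_id: "id \<in> S2 n"
  by (auto simp: S2_iff)

lemma S2_comp: assumes "g \<in> S2 n" "h \<in> S2 n" shows "g \<circ> h \<in> S2 n"
  unfolding S2_iff[of "g \<circ> h"]
proof (intro conjI allI impI)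
  show "bij (g \<circ> h)" using assms by (intro bij_comp S2_bij)
  show "(g \<circ> h) x i = x i" if "n \<le> i" for x i using S2_above[OF assms(1) that] S2_above[OF assms(2) that] by simp
  show "(g \<circ> h) x i = (g \<circ> h) y i" if "\<forall>i<n. x i = y i" "i < n" for x y i
    unfolding o_apply using that by (intro S2_below[OF assms(1)] S2_below[OF assms(2)]) auto
qed

lemma S2_maps_words: "g \<in> S2 n \<Longrightarrow> x \<in> words n \<Longrightarrow> g x \<in> words n"
  by (auto simp: words_def S2_above)

lemma S2_trunc: assumes "g \<in> S2 n" shows "trunc n (g x) = g (trunc n x)"
proof
  fix i show "trunc n (g x) i = g (trunc n x) i"
  proof (cases "i < n")
    case True
    with S2_below[OF assms, of "trunc n x" x i] show ?thesis by (simp add: trunc_nth)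
  next
    case False
    with S2_above[OF assms, of i] show ?thesis by (simp add: trunc_def)
  qed
qed

lemma S2_bij_words: assumes "g \<in> S2 n" shows "bij_betw g (words n) (words n)"
proof -
  have "inj_on g (words n)" using bij_is_inj[OF S2_bij[OF assms]] inj_on_subset by blast
  moreover have "g ` words n \<subseteq> words n" using S2_maps_words[OF assms] by auto
  ultimately show ?thesis unfolding bij_betw_def using endo_inj_surj[OF finite_words] by blast
qed

lemma S2_inv: assumes "g \<in> S2 n" shows "inv g \<in> S2 n"
proof -
  have b: "bij g" using S2_bij[OF assms] .
  have gi: "g (inv g x) = x" for x using b by (simp add: bij_is_surj surj_f_inv_f)
  have ig: "inv g (g x) = x" for x using b by (simp add: bij_is_inj)
  have ab: "inv g x i = x i" if "n \<le> i" for x i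
    using S2_above[OF assms that, of "inv g x"] gi by simp
  show ?thesis
  proof (rule S2I[OF gi ig ab])
    fix x y :: seq and i assume xy: "\<And>i. i < n \<Longrightarrow> x i = y i" and i: "i < n"
    \<comment> \<open>Truncation commutes with \<open>g\<close>, hence with its inverse; this is how
      the inverse inherits dependence on the first \<open>n\<close> bits only.\<close>
    have "trunc n (inv g z) = inv g (trunc n z)" for z
      using S2_trunc[OF assms, of "inv g z"] gi ig by metis
    moreover have "trunc n x = trunc n y" using xy by (auto simp: trunc_def)
    ultimately show "inv g x i = inv g y i" by (metis trunc_nth i)
  qed
qed

lemma S2_subset: "g \<in> S2 n \<Longrightarrow> g \<in> S2inf"
  by (auto simp: S2inf_def)

lemma S2inf_level: "g \<in> S2inf \<Longrightarrow> \<exists>n. \<forall>m\<ge>n. g \<in> S2 m"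
  using S2_mono unfolding S2inf_def by blast

lemma S2inf_common:
  assumes "finite I" "\<And>i. i \<in> I \<Longrightarrow> g i \<in> S2inf"
  shows "\<exists>n. \<forall>i\<in>I. \<forall>m\<ge>n. g i \<in> S2 m"
  using assms
proof (induction I rule: finite_induct)
  case (insert i I)
  then obtain n where n: "\<forall>j\<in>I. \<forall>m\<ge>n. g j \<in> S2 m" by auto
  from insert obtain k where "\<forall>m\<ge>k. g i \<in> S2 m" using S2inf_level[of "g i"] by auto
  with n show ?case by (intro exI[of _ "max n k"]) auto
qed auto

lemma S2inf_id [simp]: "id \<in> S2inf"
  using S2_id S2_subset by blast

lemma S2inf_comp [simp]: assumes "g \<in> S2inf" "h \<in> S2inf" shows "g \<circ> h \<in> S2inf"
proof -
  obtain n m where "\<forall>k\<ge>n. g \<in> S2 k" "\<forall>k\<ge>m. h \<in> S2 k"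
    using assms S2inf_level by presburger
  then have "g \<circ> h \<in> S2 (max n m)" by (intro S2_comp) auto
  then show ?thesis by (rule S2_subset)
qed

lemma S2inf_inv [simp]: "g \<in> S2inf \<Longrightarrow> inv g \<in> S2inf"
  using S2_inv unfolding S2inf_def by blast

lemma S2inf_bij: "g \<in> S2inf \<Longrightarrow> bij g"
  using S2_bij unfolding S2inf_def by blast

lemma S2inf_inv_apply [simp]:
  assumes "g \<in> S2inf" shows "inv g (g x) = x" "g (inv g x) = x"
  using S2inf_bij[OF assms] by (simp_all add: bij_is_inj bij_is_surj surj_f_inv_f)

lemma S2inf_inv_comp [simp]:
  assumes "g \<in> S2inf" shows "inv g \<circ> g = id" "g \<circ> inv g = id"
  using assms by (auto simp: fun_eq_iff)

lemma inv_comp: "g \<in> S2inf \<Longrightarrow> h \<in> S2inf \<Longrightarrow> inv (g \<circ> h) = inv h \<circ> inv g"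
  by (simp add: o_inv_distrib S2inf_bij)

lemma inv_inv [simp]: "g \<in> S2inf \<Longrightarrow> inv (inv g) = g"
  by (simp add: inv_inv_eq S2inf_bij)

lemma S2_eq_iff_below: assumes "g \<in> S2 n" shows "g x = x \<longleftrightarrow> (\<forall>i<n. g x i = x i)"
proof
  assume "\<forall>i<n. g x i = x i"
  then show "g x = x" using S2_above[OF assms] by (intro ext) (meson not_le)
qed simp

lemma cyl_Fix: assumes "g \<in> S2 n" shows "cyl n (Fix g)"
  unfolding cyl_def
proof (intro allI impI)
  fix x y :: seq assume *: "\<forall>i<n. x i = y i"
  then have "g x i = g y i" if "i < n" for i using S2_below[OF assms, of x y i] that by auto
  with * show "x \<in> Fix g \<longleftrightarrow> y \<in> Fix g"
    by (auto simp: Fix_def S2_eq_iff_below[OF assms])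
qed

text \<open>A cylinder of level \<open>n\<close> is the disjoint union of the elementary cylinders
  \<open>Z x\<close> of its words, each of mass \<open>(1/2) ^ n\<close>. Measures thereby become
  counts of words.\<close>

lemma mu_cyl:
  assumes C: "cyl n C"
  shows sets_mu_cyl: "C \<in> sets mu"
    and measure_mu_cyl: "measure mu C = card (C \<inter> words n) / 2 ^ n"
proof -
  interpret product_prob_space "\<lambda>_::nat. measure_pmf (bernoulli_pmf (1/2))" UNIV
    by unfold_locales
  interpret mu: prob_space mu unfolding mu_def by (rule P.prob_space_axioms)
  define Z where "Z x = {y. \<forall>i<n. y i = x i}" for x :: seq
  have Z: "Z x = prod_emb UNIV (\<lambda>_. measure_pmf (bernoulli_pmf (1/2))) {..<n} (\<Pi>\<^sub>E i\<in>{..<n}. {x i})" for x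
    by (auto simp: Z_def prod_emb_def PiE_def Pi_def)
  have sets: "Z x \<in> sets mu" for x
    unfolding Z mu_def by (rule sets_PiM_I) auto
  have em: "emeasure mu (Z x) = (\<Prod>i<n. emeasure (measure_pmf (bernoulli_pmf (1/2))) {x i})" for x
    unfolding Z mu_def by (rule emeasure_PiM_emb) auto
  have single: "emeasure (measure_pmf (bernoulli_pmf (1/2))) {b} = ennreal (1/2)" for b
    by (cases b) (simp_all add: emeasure_pmf_single)
  have meas: "measure mu (Z x) = (1/2) ^ n" for x
    unfolding measure_def em single prod_constant card_lessThan
    by (subst ennreal_power) auto
  have U: "C = (\<Union>x\<in>C \<inter> words n. Z x)"
  proof (intro equalityI subsetI)
    fix x assume "x \<in> C"
    then have "trunc n x \<in> C \<inter> words n" using cyl_trunc_iff[OF C] by auto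
    moreover have "x \<in> Z (trunc n x)" by (auto simp: Z_def trunc_def)
    ultimately show "x \<in> (\<Union>x\<in>C \<inter> words n. Z x)" by blast
  next
    fix x assume "x \<in> (\<Union>x\<in>C \<inter> words n. Z x)"
    then obtain y where "y \<in> C" "\<forall>i<n. x i = y i" by (auto simp: Z_def)
    then show "x \<in> C" using cylD[OF C, of x y] by blast
  qed
  show "C \<in> sets mu" by (subst U) (auto intro!: sets.finite_UN sets)
  have "measure mu (\<Union>x\<in>C \<inter> words n. Z x) = (\<Sum>x\<in>C \<inter> words n. measure mu (Z x))"
  proof (rule mu.finite_measure_finite_Union)
    show "disjoint_family_on Z (C \<inter> words n)"
    unfolding disjoint_family_on_def
    proof (intro ballI impI)
      fix x y assume xy: "x \<in> C \<inter> words n" "y \<in> C \<inter> words n" "x \<noteq> y"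
      then obtain i where i: "x i \<noteq> y i" by auto
      with xy have "i < n" using words_nth by blast
      with i show "Z x \<inter> Z y = {}" by (auto simp: Z_def)
    qed
  qed (auto simp: sets)
  then show "measure mu C = card (C \<inter> words n) / 2 ^ n"
    using U by (simp add: meas power_one_over)
qed

definition fixm :: "(seq \<Rightarrow> seq) \<Rightarrow> real" where
  "fixm s = measure mu (Fix s)"

lemma fixm_eq: "g \<in> S2 n \<Longrightarrow> fixm g = card (Fix g \<inter> words n) / 2 ^ n"
  unfolding fixm_def by (intro measure_mu_cyl cyl_Fix)

section \<open>Positive definiteness and far flips\<close>

locale character =
  fixes ch :: "(seq \<Rightarrow> seq) \<Rightarrow> complex"
  assumes is_char: "is_character ch"
begin

lemma central: "g \<in> S2inf \<Longrightarrow> h \<in> S2inf \<Longrightarrow> ch (g \<circ> h) = ch (h \<circ> g)"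
  using is_char unfolding is_character_def by blast

lemma char_id [simp]: "ch id = 1"
  using is_char unfolding is_character_def by blast

text \<open>Phrased as an intertwining relation, so that applications never have to compute the
  inverse of \<open>c\<close>.\<close>

lemma conj_inv:
  assumes "g \<in> S2inf" "c \<in> S2inf" "c \<circ> g = h \<circ> c" "h \<in> S2inf"
  shows "ch g = ch h"
proof -
  have "ch g = ch (inv c \<circ> (c \<circ> g))" using assms(1,2) by (simp add: o_assoc)
  also have "\<dots> = ch (inv c \<circ> (h \<circ> c))" by (simp add: assms(3))
  also have "\<dots> = ch (h \<circ> c \<circ> inv c)" using assms by (simp add: central)
  also have "\<dots> = ch h" using assms by (simp add: o_assoc[symmetric])
  finally show ?thesis .
qed

text \<open>Arbitrary finite index sets, because later forms are indexed by Booleans, options and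
  products.\<close>

lemma pos_def:
  fixes c :: "'i \<Rightarrow> complex"
  assumes "finite I" "\<And>i. i \<in> I \<Longrightarrow> g i \<in> S2inf"
  defines "q \<equiv> (\<Sum>i\<in>I. \<Sum>j\<in>I. cnj (c i) * ch (g i \<circ> inv (g j)) * c j)"
  shows "Im q = 0" "Re q \<ge> 0"
proof -
  obtain e where e: "bij_betw e {..<card I} I"
    using ex_bij_betw_nat_finite[OF assms(1)] by (auto simp: atLeast0LessThan)
  have "q = (\<Sum>i<card I. \<Sum>j<card I. cnj (c (e i)) * ch (g (e i) \<circ> inv (g (e j))) * c (e j))"
    unfolding q_def by (simp add: sum.reindex_bij_betw[OF e, symmetric])
  moreover have "\<forall>i<card I. (g \<circ> e) i \<in> S2inf"
    using bij_betwE[OF e] assms(2) by auto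
  ultimately show "Im q = 0" "Re q \<ge> 0"
    using is_char unfolding is_character_def Let_def
    by (auto dest!: spec[of _ "card I"] spec[of _ "g \<circ> e"] spec[of _ "c \<circ> e"])
qed

text \<open>The form on \<open>id\<close> and \<open>g\<close> with coefficients 1 and
  \<open>z\<close> is real: \<open>z = 1\<close> compares imaginary parts, \<open>z = \<i>\<close>
  compares real parts.\<close>

lemma char_inv: assumes g: "g \<in> S2inf" shows "ch (inv g) = cnj (ch g)"
proof -
  have [simp]: "g \<noteq> id \<Longrightarrow> inv id \<noteq> g" by simp
  have *: "Im ((1 + ch (inv g) * z) + (cnj z * ch g + cnj z * z)) = 0" for z
    using pos_def(1)[of "{False, True}" "\<lambda>b. if b then g else id" "\<lambda>b. if b then z else 1"] g
    by (simp add: o_def id_def[symmetric])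
  from *[of 1] *[of \<i>] show ?thesis by (simp add: complex_eq_iff)
qed

text \<open>Adjoin \<open>id\<close> under the index \<open>None\<close> with coefficient
  \<open>- cnj P\<close>, the choice that minimises the form. As \<open>ch id = 1\<close>, what
  remains is \<open>S\<close> minus the squared modulus of \<open>P\<close>.\<close>

lemma cauchy_schwarz:
  fixes c :: "'i \<Rightarrow> complex"
  assumes fin: "finite I" and g: "\<And>i. i \<in> I \<Longrightarrow> g i \<in> S2inf"
  shows "(cmod (\<Sum>i\<in>I. cnj (c i) * ch (g i)))\<^sup>2
    \<le> Re (\<Sum>i\<in>I. \<Sum>j\<in>I. cnj (c i) * ch (g i \<circ> inv (g j)) * c j)"
proof -
  define P where "P = (\<Sum>i\<in>I. cnj (c i) * ch (g i))"
  define S where "S = (\<Sum>i\<in>I. \<Sum>j\<in>I. cnj (c i) * ch (g i \<circ> inv (g j)) * c j)"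
  define c' where "c' = case_option (- cnj P) c"
  define g' where "g' = case_option id g"
  have Pc: "(\<Sum>j\<in>I. ch (inv (g j)) * c j) = cnj P"
    unfolding P_def by (simp add: char_inv g mult.commute)
  define J where "J = insert None (Some ` I)"
  have sumJ: "(\<Sum>i\<in>J. f i) = f None + (\<Sum>i\<in>I. f (Some i))" for f :: "'i option \<Rightarrow> complex"
    unfolding J_def using fin by (simp add: sum.reindex)
  have "(\<Sum>i\<in>J. \<Sum>j\<in>J. cnj (c' i) * ch (g' i \<circ> inv (g' j)) * c' j)
    = (P * cnj P - P * (\<Sum>j\<in>I. ch (inv (g j)) * c j)) + (\<Sum>i\<in>I. - (cnj (c i) * ch (g i) * cnj P) + (\<Sum>j\<in>I. cnj (c i) * ch (g i \<circ> inv (g j)) * c j))"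
    unfolding sumJ by (simp add: c'_def g'_def sum_distrib_left mult.assoc sum_negf)
  also have "\<dots> = - (P * cnj P) + S"
    by (simp add: Pc sum.distrib sum_negf sum_subtractf sum_distrib_right[symmetric] S_def P_def[symmetric])
  finally have eq: "(\<Sum>i\<in>J. \<Sum>j\<in>J. cnj (c' i) * ch (g' i \<circ> inv (g' j)) * c' j) = - (P * cnj P) + S" .
  have "0 \<le> Re (- (P * cnj P) + S)"
    unfolding eq[symmetric] by (rule pos_def(2)) (use fin g in \<open>auto simp: J_def g'_def\<close>)
  moreover have "Re (P * cnj P) = (cmod P)\<^sup>2"
    by (simp add: complex_norm_square[symmetric])
  ultimately show ?thesis unfolding P_def S_def by simp
qed

text \<open>The alternating sum of the first \<open>2 L\<close> terms has squared norm \<open>O(L)\<close>, while its value under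
  the character is \<open>L (a - b)\<close>.\<close>

lemma parity_average:
  fixes u :: "nat \<Rightarrow> seq \<Rightarrow> seq"
  assumes u: "\<And>k. u k \<in> S2inf"
    and F: "\<And>k l. k \<noteq> l \<Longrightarrow> ch (u k \<circ> inv (u l)) = F"
    and val: "\<And>k. ch (u k) = (if even k then a else b)"
  shows "a = b"
proof -
  have bound: "real L * (cmod (a - b))\<^sup>2 \<le> 2 * cmod (1 - F)" if "L > 0" for L :: nat
  proof -
    define c :: "nat \<Rightarrow> complex" where "c k = (if even k then 1 else -1)" for k
    \<comment> \<open>The signs cancel, so the constant \<open>F\<close> drops out of the form and
      only the excess \<open>1 - F\<close> on the diagonal survives.\<close>
    have cs: "(\<Sum>i<2*L. c i) = 0" by (induction L) (auto simp: c_def)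
    have cc: "cnj (c i) * c i = 1" for i by (simp add: c_def)
    have "(\<Sum>i<2*L. cnj (c i) * ch (u i)) = of_nat L * (a - b)"
      by (induction L) (auto simp: c_def val algebra_simps)
    moreover have "(\<Sum>i<2*L. \<Sum>j<2*L. cnj (c i) * ch (u i \<circ> inv (u j)) * c j) = of_nat (2 * L) * (1 - F)"
    proof -
      have "(\<Sum>j<2*L. cnj (c i) * ch (u i \<circ> inv (u j)) * c j) = 1 - F" if "i < 2 * L" for i
      proof -
        have "(\<Sum>j<2*L. cnj (c i) * ch (u i \<circ> inv (u j)) * c j)
          = (\<Sum>j<2*L. cnj (c i) * F * c j + (if j = i then 1 - F else 0))"
        proof (rule sum.cong[OF refl])
          fix j
          have "cnj (c i) * F * c i = F" using cc[of i] by (simp add: mult.commute mult.left_commute)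
          then show "cnj (c i) * ch (u i \<circ> inv (u j)) * c j = cnj (c i) * F * c j + (if j = i then 1 - F else 0)"
            using cc[of i] F[of i j] u[of i] by auto
        qed
        also have "\<dots> = cnj (c i) * F * (\<Sum>j<2*L. c j) + (1 - F)"
          using that by (simp add: sum.distrib sum_distrib_left)
        finally show ?thesis by (simp add: cs)
      qed
      then show ?thesis by simp
    qed
    ultimately have "(cmod (of_nat L * (a - b)))\<^sup>2 \<le> Re (of_nat (2 * L) * (1 - F))"
      using cauchy_schwarz[of "{..<2*L}" u c] u by simp
    also have "\<dots> \<le> cmod (of_nat (2 * L) * (1 - F))" by (rule complex_Re_le_cmod)
    also have "\<dots> = real L * (2 * cmod (1 - F))" by (simp add: norm_mult)
    finally have "real L * (real L * (cmod (a - b))\<^sup>2) \<le> real L * (2 * cmod (1 - F))"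
      by (simp add: norm_mult power_mult_distrib power2_eq_square mult_ac)
    with that show ?thesis by simp
  qed
  have "(cmod (a - b))\<^sup>2 \<le> 0"
  proof (rule ccontr)
    assume "\<not> (cmod (a - b))\<^sup>2 \<le> 0"
    then obtain L :: nat where "2 * cmod (1 - F) < real L * (cmod (a - b))\<^sup>2"
      using reals_Archimedean3[of "(cmod (a - b))\<^sup>2"] by auto
    moreover from this have "L > 0" by (cases L) auto
    ultimately show False using bound[of L] by simp
  qed
  then show ?thesis by simp
qed

text \<open>Conjugate by the map \<open>c\<close> that applies \<open>t\<close> only where
  \<open>\<phi>\<close> holds. On the points moved by \<open>t\<close>, the map \<open>s\<close>
  exchanges the two halves cut out by \<open>\<phi>\<close>, so exactly one of the two applications
  of \<open>c\<close> contributes a factor \<open>t\<close>.\<close>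

lemma twist_invariant:
  assumes s: "s \<in> S2 N" and t: "t \<in> S2 N" and st: "s \<circ> t = t \<circ> s" and tt: "t \<circ> t = id"
    and \<phi>: "cyl N {x. \<phi> x}" and \<phi>t: "\<And>x. \<phi> (t x) = \<phi> x"
    and \<phi>s: "\<And>x. t x \<noteq> x \<Longrightarrow> \<phi> (s x) \<longleftrightarrow> \<not> \<phi> x"
  shows "ch (s \<circ> t) = ch s"
proof -
  define c where "c x = (if \<phi> x then t x else x)" for x
  have ttx: "t (t x) = x" for x using fun_cong[OF tt, of x] by simp
  have stx: "t (s x) = s (t x)" for x using fun_cong[OF st, of x] by simp
  have cc: "c (c x) = x" for x by (simp add: c_def \<phi>t ttx)
  have c: "c \<in> S2 N"
  proof (rule S2I[where h = c, OF cc cc])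
    show "c x i = x i" if "N \<le> i" for x i using S2_above[OF t that] by (simp add: c_def)
    show "c x i = c y i" if "\<And>i. i < N \<Longrightarrow> x i = y i" "i < N" for x y i
      using cylD[OF \<phi>, of x y] that S2_below[OF t, of x y i] by (auto simp: c_def)
  qed
  have "c (s x) = s (t (c x))" for x
  proof (cases "t x = x")
    case True
    then show ?thesis using stx[of x] by (auto simp: c_def)
  next
    case False
    then show ?thesis using \<phi>s[OF False] stx[of x] by (auto simp: c_def ttx)
  qed
  then have "c \<circ> s = (s \<circ> t) \<circ> c" by (auto simp: fun_eq_iff)
  then have "ch s = ch (s \<circ> t)"
    using s t c by (intro conj_inv[of s c] S2inf_comp) (auto intro: S2_subset)
  then show ?thesis ..
qed

end

text \<open>A twist reads the coordinates below \<open>n\<close> and flips coordinates in \<open>[n, N)\<close>,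
  so the corresponding flips form an elementary abelian 2-group.\<close>

definition wflip :: "(seq \<Rightarrow> seq) \<Rightarrow> seq \<Rightarrow> seq" where
  "wflip w x = (\<lambda>i. x i \<noteq> w x i)"

definition twist :: "nat \<Rightarrow> nat \<Rightarrow> (seq \<Rightarrow> seq) \<Rightarrow> bool" where
  "twist n N w \<longleftrightarrow> (\<forall>x y. (\<forall>i<n. x i = y i) \<longrightarrow> w x = w y) \<and>
     (\<forall>x i. i < n \<or> N \<le> i \<longrightarrow> \<not> w x i)"

definition flip :: "seq set \<Rightarrow> nat \<Rightarrow> seq \<Rightarrow> seq" where
  "flip D k = wflip (\<lambda>x i. i = k \<and> x \<in> D)"

lemma twist_cong: "twist n N w \<Longrightarrow> (\<And>i. i < n \<Longrightarrow> x i = y i) \<Longrightarrow> w x = w y"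
  unfolding twist_def by blast

lemma twist_out: "twist n N w \<Longrightarrow> i < n \<or> N \<le> i \<Longrightarrow> \<not> w x i"
  unfolding twist_def by blast

lemma twistI: "(\<And>x y. (\<And>i. i < n \<Longrightarrow> x i = y i) \<Longrightarrow> w x = w y) \<Longrightarrow> (\<And>x i. w x i \<Longrightarrow> n \<le> i \<and> i < N) \<Longrightarrow> twist n N w"
  unfolding twist_def using not_le by blast

lemma twist_apply: "twist n N w \<Longrightarrow> twist n N w' \<Longrightarrow> w (wflip w' x) = w x"
  by (rule twist_cong) (auto simp: wflip_def twist_out)

lemma wflip_comp:
  "twist n N w \<Longrightarrow> twist n N w' \<Longrightarrow> wflip w \<circ> wflip w' = wflip (\<lambda>x i. w x i \<noteq> w' x i)"
  by (rule ext, simp add: twist_apply wflip_def[of w], simp add: wflip_def fun_eq_iff) blast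

lemma wflip_twice: "twist n N w \<Longrightarrow> wflip w \<circ> wflip w = id"
  by (simp add: wflip_comp, simp add: wflip_def fun_eq_iff)

lemma twist_diff: "twist n N w \<Longrightarrow> twist n N w' \<Longrightarrow> twist n N (\<lambda>x i. w x i \<noteq> w' x i)"
  unfolding twist_def by metis

lemma wflip_S2: assumes "twist n N w" "n \<le> N" shows "wflip w \<in> S2 N"
proof (rule S2I[where h = "wflip w"])
  show "wflip w (wflip w x) = x" for x
    using wflip_twice[OF assms(1)] unfolding fun_eq_iff[of "wflip w \<circ> wflip w"] by simp
  then show "wflip w (wflip w x) = x" for x .
  show "wflip w x i = x i" if "N \<le> i" for x i
    using twist_out[OF assms(1), of i x] that by (simp add: wflip_def)
  show "wflip w x i = wflip w y i" if "\<And>i. i < N \<Longrightarrow> x i = y i" "i < N" for x y i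
  proof -
    have "w x = w y" using that assms(2) by (intro twist_cong[OF assms(1)]) auto
    then show ?thesis using that by (simp add: wflip_def)
  qed
qed

lemma Fix_wflip: "Fix (wflip w) = {x. \<forall>i. \<not> w x i}"
  by (auto simp: Fix_def wflip_def fun_eq_iff)

lemma twist_flip: "cyl n D \<Longrightarrow> n \<le> k \<Longrightarrow> k < N \<Longrightarrow> twist n N (\<lambda>x i. i = k \<and> x \<in> D)"
proof (rule twistI)
  fix x y :: seq assume D: "cyl n D" and xy: "\<And>i. i < n \<Longrightarrow> x i = y i"
  show "(\<lambda>i. i = k \<and> x \<in> D) = (\<lambda>i. i = k \<and> y \<in> D)" using cylD[OF D, of x y] xy by blast
qed auto

lemma flip_S2: "cyl n D \<Longrightarrow> n \<le> k \<Longrightarrow> k < N \<Longrightarrow> flip D k \<in> S2 N"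
  unfolding flip_def by (rule wflip_S2[OF twist_flip]) auto

lemma flip_S2inf: "cyl n D \<Longrightarrow> n \<le> k \<Longrightarrow> flip D k \<in> S2inf"
  using flip_S2[of n D k "Suc k"] S2_subset by simp

lemma flip_twice: "cyl n D \<Longrightarrow> n \<le> k \<Longrightarrow> flip D k \<circ> flip D k = id"
  unfolding flip_def by (rule wflip_twice[OF twist_flip[of n D k "Suc k"]]) auto

lemma Fix_flip: "Fix (flip D k) = - D"
  by (auto simp: flip_def Fix_wflip)

lemma flip_apply: "flip D k x i = (if i = k \<and> x \<in> D then \<not> x i else x i)"
  by (simp add: flip_def wflip_def)

lemma involution_inv: "s \<circ> s = id \<Longrightarrow> inv s = s"
  by (rule inv_unique_comp)

lemma mem_Fix: "x \<in> Fix s \<longleftrightarrow> s x = x"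
  by (simp add: Fix_def)

text \<open>Serves two purposes: with \<open>A = B\<close> it says that \<open>c\<close> commutes
  with the flip, otherwise it conjugates one flip into another.\<close>

lemma flip_intertwine:
  assumes c: "c \<in> S2 n" and AB: "\<And>x. c x \<in> B \<longleftrightarrow> x \<in> A" and k: "n \<le> k"
  shows "c \<circ> flip A k = flip B k \<circ> c"
proof (intro ext)
  fix x i
  show "(c \<circ> flip A k) x i = (flip B k \<circ> c) x i"
  proof (cases "i < n")
    case True
    then have "c (flip A k x) i = c x i"
      using k by (intro S2_below[OF c]) (auto simp: flip_apply)
    with True k show ?thesis by (simp add: flip_apply)
  next
    case False
    then have "c (flip A k x) i = flip A k x i" "c x i = x i" by (auto simp: S2_above[OF c])
    with AB[of x] show ?thesis by (auto simp: flip_apply)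
  qed
qed

context character
begin

text \<open>The involution commutes with the far flip on its own moved set, and
  \<open>twist_invariant\<close> makes their product conjugate to each of them, with the roles of
  \<open>s\<close> and \<open>t\<close> exchanged in the second application.\<close>

lemma involution_eq_flip:
  assumes s: "s \<in> S2 n" and ss: "s \<circ> s = id" and k: "n \<le> k"
  shows "ch s = ch (flip (- Fix s) k)"
proof -
  define D where "D = - Fix s"
  define N where "N = Suc k"
  have ssx: "s (s x) = x" for x using fun_cong[OF ss, of x] by simp
  have D: "cyl n D" unfolding D_def by (intro cyl_Compl cyl_Fix s)
  have inv: "s x \<in> D \<longleftrightarrow> x \<in> D" for x unfolding D_def Compl_iff mem_Fix using ssx by metis
  have comm: "s \<circ> flip D k = flip D k \<circ> s" by (rule flip_intertwine[OF s inv k])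
  have sN: "s \<in> S2 N" using S2_mono[OF s] k by (simp add: N_def)
  have fN: "flip D k \<in> S2 N" using flip_S2[OF D k] by (simp add: N_def)
  \<comment> \<open>The first coordinate changed by \<open>s\<close> is the same for
    \<open>x\<close> and \<open>s x\<close>, and the two points differ there. Its bit therefore
    selects one point from each two-element orbit; \<open>\<phi>\<close> guards against fixed
    points, where \<open>j\<close> means nothing.\<close>
  define j where "j x = (LEAST i. s x i \<noteq> x i)" for x
  have j: "s x (j x) \<noteq> x (j x)" if "x \<in> D" for x
  proof -
    from that have "\<exists>i. s x i \<noteq> x i" by (auto simp: D_def Fix_def)
    then show ?thesis unfolding j_def by (rule LeastI_ex)
  qed
  have js: "j (s x) = j x" for x unfolding j_def ssx by metis
  have jn: "j x < n" if "x \<in> D" for x using j[OF that] S2_above[OF s] not_le by metis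
  define \<phi> where "\<phi> x \<longleftrightarrow> x \<in> D \<and> x (j x)" for x
  have jcong: "x \<in> D \<longleftrightarrow> y \<in> D" "x \<in> D \<Longrightarrow> j x = j y" if "\<And>i. i < n \<Longrightarrow> x i = y i" for x y
  proof -
    show "x \<in> D \<longleftrightarrow> y \<in> D" by (rule cylD[OF D]) (rule that)
    have "(s x i \<noteq> x i) = (s y i \<noteq> y i)" for i
    proof (cases "i < n")
      case True
      then show ?thesis using S2_below[OF s, of x y i] that by simp
    next
      case False
      then show ?thesis by (simp add: S2_above[OF s])
    qed
    then show "j x = j y" by (simp add: j_def)
  qed
  have \<phi>cong: "\<phi> x = \<phi> y" if "\<And>i. i < n \<Longrightarrow> x i = y i" for x y
  proof (cases "x \<in> D")
    case True
    then have "y \<in> D" "j x = j y" "x (j x) = y (j x)" using jcong[of x y] that jn[OF True] by auto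
    with True show ?thesis by (simp add: \<phi>_def)
  next
    case False
    then have "y \<notin> D" using jcong(1)[of x y] that by blast
    with False show ?thesis by (simp add: \<phi>_def)
  qed
  have cylphi: "cyl N {x. \<phi> x}"
    unfolding cyl_def mem_Collect_eq
  proof (intro allI impI)
    fix x y :: seq assume "\<forall>i<N. x i = y i"
    then show "\<phi> x = \<phi> y" using k by (intro \<phi>cong) (simp add: N_def)
  qed
  have "ch (s \<circ> flip D k) = ch s"
  proof (rule twist_invariant[OF sN fN comm flip_twice[OF D k] cylphi])
    show "\<phi> (flip D k x) = \<phi> x" for x by (rule \<phi>cong) (use k in \<open>auto simp: flip_apply\<close>)
    show "\<phi> (s x) \<longleftrightarrow> \<not> \<phi> x" if "flip D k x \<noteq> x" for x
    proof -
      have "x \<in> D" using that Fix_flip[of D k] mem_Fix by blast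
      then show ?thesis using inv[of x] js[of x] j[of x] by (auto simp: \<phi>_def)
    qed
  qed
  moreover have "ch (flip D k \<circ> s) = ch (flip D k)"
  proof (rule twist_invariant[OF fN sN comm[symmetric] ss, where \<phi> = "\<lambda>x. x k"])
    show "cyl N {x. x k}" by (simp add: cyl_def N_def)
    show "s x k = x k" for x by (rule S2_above[OF s k])
    show "flip D k x k \<longleftrightarrow> \<not> x k" if "s x \<noteq> x" for x
      using that by (simp add: flip_apply D_def mem_Fix)
  qed
  ultimately show ?thesis unfolding D_def[symmetric] comm by simp
qed

lemma involution_cong:
  assumes "s \<in> S2inf" "s \<circ> s = id" "t \<in> S2inf" "t \<circ> t = id" "Fix s = Fix t"
  shows "ch s = ch t"
proof -
  obtain n m where "s \<in> S2 n" "t \<in> S2 m" using assms(1,3) unfolding S2inf_def by blast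
  then show ?thesis
    using involution_eq_flip[of s n "max n m"] involution_eq_flip[of t m "max n m"] assms by simp
qed

end

section \<open>Characters depend only on the measure of the fixed point set\<close>

definition lift :: "nat \<Rightarrow> (seq \<Rightarrow> seq) \<Rightarrow> seq \<Rightarrow> seq" where
  "lift n \<sigma> x = (\<lambda>i. if i < n then \<sigma> (trunc n x) i else x i)"

lemma trunc_lift: "\<sigma> (trunc n x) \<in> words n \<Longrightarrow> trunc n (lift n \<sigma> x) = \<sigma> (trunc n x)"
  by (rule ext) (auto simp: trunc_def lift_def dest: words_nth)

lemma lift_comp:
  assumes "\<rho> permutes words n" shows "lift n (\<sigma> \<circ> \<rho>) = lift n \<sigma> \<circ> lift n \<rho>"
proof (intro ext)
  fix x i
  have "\<rho> (trunc n x) \<in> words n" using permutes_in_image[OF assms] by simp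
  from trunc_lift[of \<rho>, OF this] show "lift n (\<sigma> \<circ> \<rho>) x i = (lift n \<sigma> \<circ> lift n \<rho>) x i"
    by (simp add: lift_def[of n \<sigma>] lift_def[of n "\<sigma> \<circ> \<rho>"]) (simp add: lift_def)
qed

lemma lift_id: "lift n id = id"
  by (intro ext) (auto simp: lift_def trunc_def)

lemma lift_S2: assumes "\<sigma> permutes words n" shows "lift n \<sigma> \<in> S2 n"
proof (rule S2I[where h = "lift n (inv \<sigma>)"])
  have "lift n (inv \<sigma>) \<circ> lift n \<sigma> = id" "lift n \<sigma> \<circ> lift n (inv \<sigma>) = id"
    using lift_comp[OF assms, of "inv \<sigma>"] lift_comp[OF permutes_inv[OF assms], of \<sigma>]
    by (simp_all add: permutes_inv_o[OF assms] lift_id)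
  then show "lift n (inv \<sigma>) (lift n \<sigma> x) = x" "lift n \<sigma> (lift n (inv \<sigma>) x) = x" for x
    by (metis comp_apply id_apply)+
  show "lift n \<sigma> x i = x i" if "n \<le> i" for x i using that by (simp add: lift_def)
  show "lift n \<sigma> x i = lift n \<sigma> y i" if "\<And>i. i < n \<Longrightarrow> x i = y i" "i < n" for x y i
  proof -
    have "trunc n x = trunc n y" using that(1) by (auto simp: trunc_def)
    with that(2) show ?thesis by (simp add: lift_def)
  qed
qed

text \<open>Exhibits \<open>g\<close> as a permutation of its finitely many moved words, which opens
  the way to induction over transpositions.\<close>

lemma S2_eq_lift:
  assumes g: "g \<in> S2 n"
  defines "\<sigma> \<equiv> \<lambda>x. if x \<in> words n then g x else x"
  shows "\<sigma> permutes words n - Fix g" "g = lift n \<sigma>"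
proof -
  have "bij_betw \<sigma> (words n) (words n)"
    using S2_bij_words[OF g] by (subst bij_betw_cong[of _ _ g]) (auto simp: \<sigma>_def)
  then have "\<sigma> permutes words n" by (rule bij_imp_permutes) (simp add: \<sigma>_def)
  then show "\<sigma> permutes words n - Fix g" by (rule permutes_superset) (auto simp: \<sigma>_def Fix_def)
  show "g = lift n \<sigma>"
  proof (intro ext)
    fix x i
    have "g x i = (if i < n then trunc n (g x) i else x i)"
      by (simp add: trunc_nth S2_above[OF g])
    then show "g x i = lift n \<sigma> x i" by (simp only: lift_def \<sigma>_def S2_trunc[OF g] trunc_in_words if_True)
  qed
qed

text \<open>Equal counts inside force equal counts outside, so a bijection of the words in
  \<open>A\<close> with those in \<open>B\<close> can be glued to one between the
  complements.\<close>

lemma S2_map_cyl: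
  assumes A: "cyl n A" and B: "cyl n B" and card: "card (A \<inter> words n) = card (B \<inter> words n)"
  shows "\<exists>c\<in>S2 n. \<forall>x. c x \<in> B \<longleftrightarrow> x \<in> A"
proof -
  obtain h1 where h1: "bij_betw h1 (A \<inter> words n) (B \<inter> words n)"
    using card by (metis finite_Int finite_words finite_same_card_bij)
  have "card (words n - A) = card (words n) - card (A \<inter> words n)" "card (words n - B) = card (words n) - card (B \<inter> words n)"
    by (simp_all add: card_Diff_subset_Int Int_commute)
  then obtain h2 where h2: "bij_betw h2 (words n - A) (words n - B)"
    using card by (metis finite_Diff finite_words finite_same_card_bij)
  define \<sigma> where "\<sigma> x = (if x \<in> A \<inter> words n then h1 x else if x \<in> words n then h2 x else x)" for x
  have s1: "bij_betw \<sigma> (A \<inter> words n) (B \<inter> words n)"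
    using h1 by (subst bij_betw_cong[of _ _ h1]) (auto simp: \<sigma>_def)
  have s2: "bij_betw \<sigma> (words n - A) (words n - B)"
    using h2 by (subst bij_betw_cong[of _ _ h2]) (auto simp: \<sigma>_def)
  have "bij_betw \<sigma> ((A \<inter> words n) \<union> (words n - A)) ((B \<inter> words n) \<union> (words n - B))"
    by (rule bij_betw_combine[OF s1 s2]) auto
  moreover have "(A \<inter> words n) \<union> (words n - A) = words n" "(B \<inter> words n) \<union> (words n - B) = words n" by auto
  ultimately have p: "\<sigma> permutes words n" by (intro bij_imp_permutes) (auto simp: \<sigma>_def)
  have "lift n \<sigma> x \<in> B \<longleftrightarrow> x \<in> A" for x
  proof -
    have "lift n \<sigma> x \<in> B \<longleftrightarrow> \<sigma> (trunc n x) \<in> B"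
      using cyl_trunc_iff[OF B, of "lift n \<sigma> x"] trunc_lift[of \<sigma> n x] permutes_in_image[OF p] by simp
    also have "\<dots> \<longleftrightarrow> trunc n x \<in> A"
      using bij_betwE[OF s1] bij_betwE[OF s2] trunc_in_words[of n x] by blast
    also have "\<dots> \<longleftrightarrow> x \<in> A" by (rule cyl_trunc_iff[OF A])
    finally show ?thesis .
  qed
  then show ?thesis using lift_S2[OF p] by blast
qed

lemma support_invariant:
  assumes "inj g" and "- Fix g \<subseteq> D" shows "g x \<in> D \<longleftrightarrow> x \<in> D"
proof (cases "g x = x")
  case False
  then have "g (g x) \<noteq> g x" using injD[OF assms(1)] by blast
  with False show ?thesis using assms(2) by (auto simp: Fix_def)
qed simp

lemma inv_Fix_iff: assumes "g \<in> S2inf" shows "inv g x = x \<longleftrightarrow> g x = x"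
  using S2inf_inv_apply[OF assms, of x] by metis

lemma S2_swap:
  assumes "k < N" "l < N"
  shows "(\<lambda>x. x \<circ> Transposition.transpose k l) \<in> S2 N"
proof (rule S2I[where h = "\<lambda>x. x \<circ> Transposition.transpose k l"])
  show "x \<circ> Transposition.transpose k l \<circ> Transposition.transpose k l = x" for x :: seq
    by (simp add: o_assoc[symmetric])
  then show "x \<circ> Transposition.transpose k l \<circ> Transposition.transpose k l = x" for x :: seq .
  show "(x \<circ> Transposition.transpose k l) i = x i" if "N \<le> i" for x :: seq and i
    using that assms by (simp add: Transposition.transpose_def)
  show "(x \<circ> Transposition.transpose k l) i = (y \<circ> Transposition.transpose k l) i"
    if "\<And>i. i < N \<Longrightarrow> x i = y i" "i < N" for x y :: seq and i
    using that assms by (simp add: Transposition.transpose_def)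
qed

section \<open>Flips absorb elements supported in their moved set\<close>

context character
begin

text \<open>Conjugation by the exchange of coordinates \<open>k\<close> and \<open>l\<close>, which
  neither \<open>D\<close> nor \<open>v\<close> can see.\<close>

lemma flip_coordinate:
  assumes D: "cyl n D" and v: "v \<in> S2 n" and k: "n \<le> k" and l: "n \<le> l"
  shows "ch (flip D k \<circ> v) = ch (flip D l \<circ> v)"
proof -
  define t where "t = Transposition.transpose k l"
  have t: "i < n \<Longrightarrow> t i = i" "\<not> i < n \<Longrightarrow> \<not> t i < n" "t i = k \<longleftrightarrow> i = l" for i
    using k l by (auto simp: t_def Transposition.transpose_def)
  have "c \<in> S2inf" if "c = (\<lambda>x. x \<circ> t)" for c
    unfolding that t_def by (rule S2_subset[OF S2_swap[of _ "Suc (max k l)"]]) auto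
  moreover have "(\<lambda>x. x \<circ> t) \<circ> (flip D k \<circ> v) = (flip D l \<circ> v) \<circ> (\<lambda>x. x \<circ> t)"
  proof (intro ext)
    fix x i
    have D': "v (x \<circ> t) \<in> D \<longleftrightarrow> v x \<in> D"
      by (rule cylD[OF D], rule S2_below[OF v]) (auto simp: t)
    have vt: "v (x \<circ> t) i = v x (t i)" for i
    proof (cases "i < n")
      case True
      then show ?thesis unfolding t(1)[OF True] by (intro S2_below[OF v]) (auto simp: t)
    next
      case False
      with t(2)[OF False] show ?thesis by (simp add: S2_above[OF v])
    qed
    show "((\<lambda>x. x \<circ> t) \<circ> (flip D k \<circ> v)) x i = ((flip D l \<circ> v) \<circ> (\<lambda>x. x \<circ> t)) x i"
      using vt[of i] D' t(3)[of i] by (auto simp: flip_apply)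
  qed
  ultimately show ?thesis
    using flip_S2inf[OF D k] flip_S2inf[OF D l] S2_subset[OF v]
    by (intro conj_inv[of _ "\<lambda>x. x \<circ> t"]) auto
qed

text \<open>The three factors commute, so the product is an involution. Since \<open>j\<close> and
  \<open>l\<close> differ, bit \<open>j\<close> changes at every point of \<open>D\<close> whatever
  \<open>r\<close> does below \<open>n\<close>; the fixed point set is thus the complement of
  \<open>D\<close>, and it alone determines the value.\<close>

lemma double_flip:
  assumes D: "cyl n D" and r: "r \<in> S2 n" "r \<circ> r = id" "- Fix r \<subseteq> D"
    and jl: "n \<le> j" "n \<le> l" "j \<noteq> l"
  shows "ch (flip D j \<circ> r \<circ> flip D l) = ch (flip D n)"
proof -
  have rD: "r x \<in> D \<longleftrightarrow> x \<in> D" for x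
    by (rule support_invariant[OF bij_is_inj[OF S2_bij[OF r(1)]] r(3)])
  have fD: "flip D k x \<in> D \<longleftrightarrow> x \<in> D" if "n \<le> k" for k x
    by (rule cylD[OF D]) (use that in \<open>auto simp: flip_apply\<close>)
  have rrx: "r (r x) = x" for x using fun_cong[OF r(2), of x] by simp
  have rx: "r x = x" if "x \<notin> D" for x using that r(3) by (auto simp: Fix_def)
  have comm: "r (flip D k x) = flip D k (r x)" if "n \<le> k" for k x
    using fun_cong[OF flip_intertwine[OF r(1) rD that], of x] by simp
  have ff: "flip D k (flip D k x) = x" if "n \<le> k" for k x
    using fun_cong[OF flip_twice[OF D that], of x] by simp
  have fcomm: "flip D j (flip D l x) = flip D l (flip D j x)" for x
    using fD jl by (auto simp: fun_eq_iff flip_apply)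
  show ?thesis
  proof (rule involution_cong)
    show "flip D j \<circ> r \<circ> flip D l \<in> S2inf" "flip D n \<in> S2inf"
      using flip_S2inf[OF D] jl S2_subset[OF r(1)] by auto
    show "flip D n \<circ> flip D n = id" by (rule flip_twice[OF D order_refl])
    show "(flip D j \<circ> r \<circ> flip D l) \<circ> (flip D j \<circ> r \<circ> flip D l) = id"
      using jl by (intro ext) (simp add: comm fcomm ff rrx)
    show "Fix (flip D j \<circ> r \<circ> flip D l) = Fix (flip D n)"
    proof -
      have "(flip D j (r (flip D l x)) = x) \<longleftrightarrow> x \<notin> D" for x
      proof
        assume "x \<notin> D"
        then have "flip D k x = x" for k by (intro ext) (simp add: flip_apply)
        then show "flip D j (r (flip D l x)) = x" using rx[OF \<open>x \<notin> D\<close>] by simp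
      next
        assume eq: "flip D j (r (flip D l x)) = x"
        show "x \<notin> D"
        proof
          assume "x \<in> D"
          then have "r (flip D l x) \<in> D" using rD fD jl by blast
          then have "flip D j (r (flip D l x)) j = (\<not> r (flip D l x) j)" by (simp add: flip_apply)
          also have "r (flip D l x) j = x j" using jl by (simp add: S2_above[OF r(1)] flip_apply)
          finally show False using eq by simp
        qed
      qed
      then show ?thesis unfolding Fix_flip set_eq_iff mem_Fix o_apply Compl_iff by blast
    qed
  qed
qed

text \<open>\<open>parity_average\<close> is applied to flips at different coordinates, composed
  alternately with \<open>g \<circ> v\<close> and \<open>v\<close>. In a quotient of two members the
  factor \<open>v\<close> cancels and leaves \<open>id\<close> or \<open>g\<close> between two
  flips, which is the situation of \<open>double_flip\<close>.\<close>

lemma flip_absorbs_involution: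
  assumes D: "cyl n D" and g: "g \<in> S2 n" "g \<circ> g = id" "- Fix g \<subseteq> D" and v: "v \<in> S2 n" and k: "n \<le> k"
  shows "ch (flip D k \<circ> (g \<circ> v)) = ch (flip D k \<circ> v)"
proof (rule parity_average)
  define a where "a j = (if even j then g \<circ> v else v)" for j :: nat
  define u where "u j = flip D (n + j) \<circ> a j" for j
  have gv: "g \<in> S2inf" "v \<in> S2inf" using g v by (auto intro: S2_subset)
  have a: "a j \<in> S2 n" "a j \<in> S2inf" for j
    using S2_comp[OF g(1) v] v gv by (auto simp: a_def)
  have f: "flip D (n + j) \<in> S2inf" for j by (rule flip_S2inf[OF D]) simp
  show "u j \<in> S2inf" for j using a f by (simp add: u_def)
  show "ch (u j) = (if even j then ch (flip D k \<circ> (g \<circ> v)) else ch (flip D k \<circ> v))" for j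
    using flip_coordinate[OF D a(1)[of j], of "n + j" k] k by (simp add: u_def) (simp add: a_def)
  show "ch (u j \<circ> inv (u l)) = ch (flip D n)" if "j \<noteq> l" for j l
  proof -
    have fi: "inv (flip D (n + l)) = flip D (n + l)"
      by (rule involution_inv, rule flip_twice[OF D]) simp
    define r where "r = a j \<circ> inv (a l)"
    have gi: "inv g = g" by (rule involution_inv[OF g(2)])
    have "r = id \<or> r = g"
    proof (cases "even j = even l")
      case True
      then have "a j = a l" by (simp add: a_def)
      then show ?thesis using a(2) by (simp add: r_def)
    next
      case False
      have vv: "v \<circ> (inv v \<circ> g) = g" "g \<circ> v \<circ> inv v = g"
        using gv by (simp add: o_assoc) (simp add: o_assoc[symmetric] gv)
      have "inv (g \<circ> v) = inv v \<circ> g" using gv by (simp add: inv_comp gi)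
      with False vv show ?thesis by (auto simp: r_def a_def)
    qed
    then have "ch (flip D (n + j) \<circ> r \<circ> flip D (n + l)) = ch (flip D n)"
      using that g S2_id[of n] by (intro double_flip[OF D]) (auto simp: Fix_def)
    moreover have "u j \<circ> inv (u l) = flip D (n + j) \<circ> r \<circ> flip D (n + l)"
      unfolding u_def r_def using a f by (simp add: inv_comp fi o_assoc)
    ultimately show ?thesis by simp
  qed
qed

text \<open>A transposition of two words of \<open>D\<close> is an involution supported in
  \<open>D\<close>. The free factor \<open>v\<close> lets the induction peel off one transposition
  after another from the left.\<close>

lemma flip_absorbs:
  assumes D: "cyl n D" and g: "g \<in> S2 n" "- Fix g \<subseteq> D" and v: "v \<in> S2 n" and k: "n \<le> k"
  shows "ch (flip D k \<circ> (g \<circ> v)) = ch (flip D k \<circ> v)"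
proof -
  define \<sigma> where "\<sigma> = (\<lambda>x. if x \<in> words n then g x else x)"
  have gl: "g = lift n \<sigma>" and "\<sigma> permutes words n - Fix g"
    unfolding \<sigma>_def by (rule S2_eq_lift[OF g(1)])+
  from this(2) have "\<sigma> permutes words n \<inter> D" by (rule permutes_subset) (use g(2) in blast)
  moreover have "finite (words n \<inter> D)" by simp
  ultimately have "\<forall>v\<in>S2 n. ch (flip D k \<circ> (lift n \<sigma> \<circ> v)) = ch (flip D k \<circ> v)"
  proof (induction \<sigma> rule: permutes_induct)
    case id
    show ?case unfolding lift_id[unfolded id_def] id_def comp_def by simp
  next
    case (swap a b p)
    have p: "p permutes words n" using swap by (auto intro: permutes_subset)
    define \<tau> where "\<tau> = lift n (Transposition.transpose a b)"
    have ab: "Transposition.transpose a b permutes words n" using swap by (intro permutes_swap_id) auto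
    have \<tau>: "\<tau> \<in> S2 n" unfolding \<tau>_def by (rule lift_S2[OF ab])
    have \<tau>\<tau>: "\<tau> \<circ> \<tau> = id" unfolding \<tau>_def lift_comp[OF ab, symmetric] by (simp add: lift_id)
    have \<tau>D: "- Fix \<tau> \<subseteq> D"
    proof
      fix x assume "x \<in> - Fix \<tau>"
      then have "\<tau> x \<noteq> x" by (simp add: Fix_def)
      then obtain i where "i < n" "\<tau> x i \<noteq> x i" using S2_eq_iff_below[OF \<tau>] by blast
      then have "Transposition.transpose a b (trunc n x) \<noteq> trunc n x"
        by (metis \<tau>_def lift_def trunc_nth)
      then have "trunc n x \<in> {a, b}" by (auto simp: Transposition.transpose_def split: if_splits)
      then have "trunc n x \<in> D" using swap by auto
      then show "x \<in> D" by (simp add: cyl_trunc_iff[OF D])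
    qed
    show ?case
    proof
      fix v assume v: "v \<in> S2 n"
      have lp: "lift n p \<in> S2 n" by (rule lift_S2[OF p])
      have "ch (flip D k \<circ> (lift n (Transposition.transpose a b \<circ> p) \<circ> v)) = ch (flip D k \<circ> (\<tau> \<circ> (lift n p \<circ> v)))"
        by (simp add: lift_comp[OF p] \<tau>_def o_assoc)
      also have "\<dots> = ch (flip D k \<circ> (lift n p \<circ> v))"
        by (rule flip_absorbs_involution[OF D \<tau> \<tau>\<tau> \<tau>D S2_comp[OF lp v] k])
      also have "\<dots> = ch (flip D k \<circ> v)" using swap v by blast
      finally show "ch (flip D k \<circ> (lift n (Transposition.transpose a b \<circ> p) \<circ> v)) = ch (flip D k \<circ> v)" .
    qed
  qed
  with v gl show ?thesis by simp
qed

text \<open>Conjugating \<open>g\<close> by the map that adds the first \<open>n\<close> bits to a far block yields a far flip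
  composed with \<open>g\<close>, and that flip moves exactly the points moved by \<open>g\<close>.\<close>

lemma char_eq_flip:
  assumes g: "g \<in> S2 n" and n: "0 < n"
  shows "ch g = ch (flip (- Fix g) n)"
proof (rule parity_average)
  define D where "D = - Fix g"
  \<comment> \<open>Block \<open>k\<close> occupies the \<open>n\<close> coordinates from
    \<open>n * (k + 1)\<close> on: the blocks are pairwise disjoint, avoid the first
    \<open>n\<close> coordinates, and each has room for a copy of a word of length
    \<open>n\<close>.\<close>
  define off where "off k = n * (k + 1)" for k
  define copy where "copy k x i \<longleftrightarrow> off k \<le> i \<and> i < off k + n \<and> x (i - off k)" for k i and x :: seq
  \<comment> \<open>The even case is the offset left over when \<open>g\<close> is conjugated by
    \<open>wflip (copy k)\<close>; the odd case is a single bit. Both are nonzero exactly on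
    \<open>D\<close> and live in block \<open>k\<close>, so for different \<open>k\<close> and
    \<open>l\<close> the quotient of \<open>u k\<close> and \<open>u l\<close> is an involution that
    moves exactly \<open>D\<close>.\<close>
  define w where "w k = (if even k then (\<lambda>x i. copy k x i \<noteq> copy k (inv g x) i) else (\<lambda>x i. i = off k \<and> x \<in> D))" for k
  define u where "u k = wflip (w k) \<circ> g" for k
  have D: "cyl n D" unfolding D_def by (intro cyl_Compl cyl_Fix g)
  have gi: "g \<in> S2inf" "inv g \<in> S2 n" using g S2_inv by (auto intro: S2_subset)
  have off: "n \<le> off k" for k by (simp add: off_def)
  have tc: "twist n N (copy k)" if "off k + n \<le> N" for k N
  proof (rule twistI)
    show "copy k x = copy k y" if "\<And>i. i < n \<Longrightarrow> x i = y i" for x y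
      using that by (intro ext) (auto simp: copy_def)
    show "n \<le> i \<and> i < N" if "copy k x i" for x i
      using that off[of k] \<open>off k + n \<le> N\<close> by (simp add: copy_def)
  qed
  have block: "off k \<le> i \<and> i < off k + n" if "w k x i" for k x i
    using that n by (auto simp: w_def copy_def split: if_splits)
  have tw: "twist n N (w k)" if N: "off k + n \<le> N" for k N
  proof (rule twistI)
    show "w k x = w k y" if xy: "\<And>i. i < n \<Longrightarrow> x i = y i" for x y
    proof -
      have "copy k x = copy k y" by (rule twist_cong[OF tc[OF N] xy])
      moreover have "copy k (inv g x) = copy k (inv g y)"
        by (rule twist_cong[OF tc[OF N]], rule S2_below[OF gi(2) xy])
      moreover have "x \<in> D \<longleftrightarrow> y \<in> D" by (rule cylD[OF D]) (rule xy)
      ultimately show ?thesis by (simp add: w_def)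
    qed
    show "n \<le> i \<and> i < N" if "w k x i" for x i
      using block[OF that] off[of k] N by simp
  qed
  have wD: "(\<exists>i. w k x i) \<longleftrightarrow> x \<in> D" for k x
  proof (cases "even k")
    case True
    have "(\<exists>i. w k x i) \<longleftrightarrow> (\<exists>i<n. x i \<noteq> inv g x i)"
    proof
      assume "\<exists>i. w k x i"
      then obtain i where i: "w k x i" by blast
      with True block[OF i] have "i - off k < n" "x (i - off k) \<noteq> inv g x (i - off k)"
        by (auto simp: w_def copy_def)
      then show "\<exists>i<n. x i \<noteq> inv g x i" by blast
    next
      assume "\<exists>i<n. x i \<noteq> inv g x i"
      then obtain i where "i < n" "x i \<noteq> inv g x i" by blast
      with True have "w k x (off k + i)" by (simp add: w_def copy_def)
      then show "\<exists>i. w k x i" by blast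
    qed
    also have "\<dots> \<longleftrightarrow> inv g x \<noteq> x" using S2_eq_iff_below[OF gi(2), of x] by auto
    also have "\<dots> \<longleftrightarrow> x \<in> D" using inv_Fix_iff[OF gi(1)] by (simp add: D_def Fix_def)
    finally show ?thesis .
  qed (simp add: w_def)
  have W: "wflip (w k) \<in> S2inf" for k
    by (rule S2_subset[OF wflip_S2[OF tw[OF order_refl]]]) (simp add: off_def)
  show "u k \<in> S2inf" for k using W gi by (simp add: u_def)
  show "ch (u k \<circ> inv (u l)) = ch (flip D n)" if "k \<noteq> l" for k l
  proof -
    define N where "N = max (off k + n) (off l + n)"
    have tk: "twist n N (w k)" "twist n N (w l)" by (auto intro!: tw simp: N_def)
    have td: "twist n N (\<lambda>x i. w k x i \<noteq> w l x i)" by (rule twist_diff[OF tk])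
    have "inv (wflip (w l)) = wflip (w l)" by (rule involution_inv[OF wflip_twice[OF tk(2)]])
    then have "u k \<circ> inv (u l) = wflip (w k) \<circ> (g \<circ> inv g) \<circ> wflip (w l)"
      unfolding u_def using W gi(1) by (simp only: inv_comp o_assoc)
    then have eq: "u k \<circ> inv (u l) = wflip (\<lambda>x i. w k x i \<noteq> w l x i)"
      using gi(1) wflip_comp[OF tk] by simp
    have disj: "\<not> w l x i" if "w k x i" for x i
    proof
      assume "w l x i"
      from block[OF this] block[OF that] have "n * (k+1) < n * (l + 2)" "n * (l+1) < n * (k + 2)"
        by (auto simp: off_def)
      then have "k + 1 < l + 2" "l + 1 < k + 2" by (simp_all only: mult_less_cancel1)
      then show False using \<open>k \<noteq> l\<close> by simp
    qed
    have "(\<exists>i. w k x i \<noteq> w l x i) \<longleftrightarrow> x \<in> D" for x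
      using wD[of k x] wD[of l x] disj by blast
    then have "Fix (wflip (\<lambda>x i. w k x i \<noteq> w l x i)) = - D" by (auto simp: Fix_wflip)
    then show ?thesis unfolding eq
      using wflip_twice[OF td] S2_subset[OF wflip_S2[OF td]] off[of k] flip_S2inf[OF D order_refl] flip_twice[OF D order_refl]
      by (intro involution_cong) (auto simp: Fix_flip N_def)
  qed
  show "ch (u k) = (if even k then ch g else ch (flip (- Fix g) n))" for k
  proof (cases "even k")
    case True
    define c where "c = wflip (copy k)"
    have c: "c \<in> S2inf" unfolding c_def
      by (rule S2_subset[OF wflip_S2[OF tc[OF order_refl]]]) (simp add: off_def)
    have "c \<circ> g = u k \<circ> c"
    proof (intro ext)
      fix x i
      have cx: "c x i = x i" if "i < n" for x i
        using that off[of k] by (simp add: c_def wflip_def copy_def)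
      have gc: "g (c x) i = g x i" if "i < n" for i by (rule S2_below[OF g cx that])
      have "w k (g (c x)) = w k (g x)" by (rule twist_cong[OF tw[OF order_refl] gc])
      then have "(u k \<circ> c) x i = (g (c x) i \<noteq> (copy k (g x) i \<noteq> copy k x i))"
        using True gi(1) by (simp add: u_def wflip_def w_def)
      also have "g (c x) i = (g x i \<noteq> copy k x i)"
      proof (cases "i < n")
        case True
        then show ?thesis using gc[OF True] off[of k] by (simp add: copy_def)
      next
        case False
        then show ?thesis by (simp add: S2_above[OF g] c_def wflip_def)
      qed
      finally show "(c \<circ> g) x i = (u k \<circ> c) x i" by (auto simp: c_def wflip_def)
    qed
    then have "ch g = ch (u k)"
      by (rule conj_inv[OF gi(1) c]) (use W gi in \<open>simp add: u_def\<close>)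
    with True show ?thesis by simp
  next
    case False
    then have "u k = flip D (off k) \<circ> (g \<circ> id)" by (simp add: u_def w_def flip_def)
    then have "ch (u k) = ch (flip D (off k) \<circ> id)"
      using flip_absorbs[OF D g _ S2_id off[of k]] by (simp add: D_def)
    also have "\<dots> = ch (flip D n \<circ> id)" by (rule flip_coordinate[OF D S2_id off order_refl])
    finally show ?thesis using False by (simp add: D_def)
  qed
qed

text \<open>Both elements may be replaced by far flips. Equal fixed measure means equally many moved
  words at a common level, so an element of that level carries one moved set to the other and
  conjugates the flips.\<close>

lemma char_fixm_cong:
  assumes "g \<in> S2inf" "h \<in> S2inf" "fixm g = fixm h"
  shows "ch g = ch h"
proof -
  obtain n1 n2 where n12: "\<forall>m\<ge>n1. g \<in> S2 m" "\<forall>m\<ge>n2. h \<in> S2 m"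
    using assms S2inf_level by presburger
  \<comment> \<open>The level is kept positive for \<open>char_eq_flip\<close>, whose blocks must
    contain at least one bit.\<close>
  define n where "n = max 1 (max n1 n2)"
  have g: "g \<in> S2 n" and h: "h \<in> S2 n" and n: "0 < n" using n12 by (auto simp: n_def)
  define A B where "A = - Fix g" and "B = - Fix h"
  have A: "cyl n A" and B: "cyl n B" unfolding A_def B_def by (intro cyl_Compl cyl_Fix g h)+
  have "card (Fix g \<inter> words n) = card (Fix h \<inter> words n)"
    using assms(3) by (simp add: fixm_eq[OF g] fixm_eq[OF h])
  moreover have "- C \<inter> words n = words n - (C \<inter> words n)" for C by auto
  ultimately have "card (A \<inter> words n) = card (B \<inter> words n)"
    unfolding A_def B_def by (simp add: card_Diff_subset)
  then obtain c where c: "c \<in> S2 n" "\<And>x. c x \<in> B \<longleftrightarrow> x \<in> A" using S2_map_cyl[OF A B] by blast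
  have "ch (flip A n) = ch (flip B n)"
    by (rule conj_inv[OF _ _ flip_intertwine[OF c(1) c(2) order_refl]])
       (auto intro: S2_subset[OF c(1)] flip_S2inf[OF A] flip_S2inf[OF B])
  then show ?thesis using char_eq_flip[OF g n] char_eq_flip[OF h n] by (simp add: A_def B_def)
qed

end

section \<open>Shifted elements and independence\<close>

definition shift_by :: "nat \<Rightarrow> (seq \<Rightarrow> seq) \<Rightarrow> seq \<Rightarrow> seq" where
  "shift_by N h x = (\<lambda>i. if i < N then x i else h (\<lambda>j. x (j + N)) (i - N))"

lemma shift_by_below: "i < N \<Longrightarrow> shift_by N h x i = x i"
  by (simp add: shift_by_def)

lemma shift_by_tail: "(\<lambda>j. shift_by N h x (j + N)) = h (\<lambda>j. x (j + N))"
  by (simp add: shift_by_def)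

lemma shift_by_comp: "shift_by N g \<circ> shift_by N h = shift_by N (g \<circ> h)"
proof (intro ext)
  fix x i
  show "(shift_by N g \<circ> shift_by N h) x i = shift_by N (g \<circ> h) x i"
    unfolding o_apply shift_by_def[of N g] shift_by_tail by (simp add: shift_by_def)
qed

lemma shift_by_id: "shift_by N id = id"
  by (intro ext) (simp add: shift_by_def)

lemma shift_by_S2: assumes h: "h \<in> S2 n" shows "shift_by N h \<in> S2 (N + n)"
proof (rule S2I[where h = "shift_by N (inv h)"])
  have "h \<in> S2inf" using S2_subset[OF h] .
  then have "shift_by N (inv h) \<circ> shift_by N h = id" "shift_by N h \<circ> shift_by N (inv h) = id"
    by (simp_all add: shift_by_comp shift_by_id)
  then show "shift_by N (inv h) (shift_by N h x) = x" "shift_by N h (shift_by N (inv h) x) = x" for x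
    by (metis comp_apply id_apply)+
  show "shift_by N h x i = x i" if "N + n \<le> i" for x i
  proof -
    have "h (\<lambda>j. x (j + N)) (i - N) = x (i - N + N)" using that by (intro S2_above[OF h]) simp
    with that show ?thesis by (simp add: shift_by_def)
  qed
  show "shift_by N h x i = shift_by N h y i" if xy: "\<And>i. i < N + n \<Longrightarrow> x i = y i" "i < N + n" for x y i
  proof (cases "i < N")
    case True
    then show ?thesis using xy by (simp add: shift_by_def)
  next
    case False
    have "h (\<lambda>j. x (j + N)) (i - N) = h (\<lambda>j. y (j + N)) (i - N)"
      by (rule S2_below[OF h]) (use xy False in auto)
    with False show ?thesis by (simp add: shift_by_def)
  qed
qed

lemma shift_by_S2inf: "h \<in> S2inf \<Longrightarrow> shift_by N h \<in> S2inf"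
  using shift_by_S2 unfolding S2inf_def by blast

lemma shift_by_inv: assumes "h \<in> S2inf" shows "inv (shift_by N h) = shift_by N (inv h)"
  using assms by (intro inv_unique_comp) (simp_all add: shift_by_comp shift_by_id)

lemma shift_by_apply_far: "g \<in> S2 N \<Longrightarrow> i < N \<Longrightarrow> g (shift_by N h x) i = g x i"
  by (rule S2_below) (simp_all add: shift_by_below)

lemma shift_by_commute: assumes g: "g \<in> S2 N" shows "g \<circ> shift_by N h = shift_by N h \<circ> g"
proof (intro ext)
  fix x i
  have t: "(\<lambda>j. g x (j + N)) = (\<lambda>j. x (j + N))" by (simp add: S2_above[OF g])
  show "(g \<circ> shift_by N h) x i = (shift_by N h \<circ> g) x i"
  proof (cases "i < N")
    case True
    then show ?thesis by (simp add: shift_by_apply_far[OF g] shift_by_below)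
  next
    case False
    then show ?thesis by (simp add: S2_above[OF g] shift_by_def t)
  qed
qed

lemma Fix_comp_shift_by:
  assumes g: "g \<in> S2 N"
  shows "Fix (g \<circ> shift_by N h) = Fix g \<inter> {x. (\<lambda>j. x (j + N)) \<in> Fix h}"
proof -
  have "g (shift_by N h x) = x \<longleftrightarrow> g x = x \<and> h (\<lambda>j. x (j + N)) = (\<lambda>j. x (j + N))" for x
  proof -
    have "g (shift_by N h x) = x \<longleftrightarrow> (\<forall>i<N. g (shift_by N h x) i = x i) \<and> (\<forall>j. g (shift_by N h x) (j + N) = x (j + N))"
      unfolding fun_eq_iff by (metis add.commute le_Suc_ex not_le)
    also have "(\<forall>i<N. g (shift_by N h x) i = x i) \<longleftrightarrow> g x = x"
      unfolding S2_eq_iff_below[OF g, of x] by (simp add: shift_by_apply_far[OF g])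
    also have "(\<forall>j. g (shift_by N h x) (j + N) = x (j + N)) \<longleftrightarrow> h (\<lambda>j. x (j + N)) = (\<lambda>j. x (j + N))"
      unfolding fun_eq_iff by (simp add: S2_above[OF g] shift_by_def)
    finally show ?thesis .
  qed
  then show ?thesis by (simp add: Fix_def set_eq_iff)
qed

text \<open>Independence: a word of length \<open>N + n\<close> is a pair of words of lengths
  \<open>N\<close> and \<open>n\<close>, and being fixed is a condition on each component
  separately.\<close>

lemma fixm_comp_shift_by:
  assumes g: "g \<in> S2 N" and h: "h \<in> S2inf"
  shows "fixm (g \<circ> shift_by N h) = fixm g * fixm h"
proof -
  obtain n where h: "h \<in> S2 n" using h unfolding S2inf_def by blast
  define A where "A = Fix (g \<circ> shift_by N h) \<inter> words (N + n)"
  have gh: "g \<circ> shift_by N h \<in> S2 (N + n)"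
    by (intro S2_comp shift_by_S2 h S2_mono[OF g]) simp
  have "bij_betw (\<lambda>x. (trunc N x, \<lambda>j. x (j + N))) A ((Fix g \<inter> words N) \<times> (Fix h \<inter> words n))"
  proof (rule bij_betw_byWitness[where f' = "\<lambda>(y, z) i. if i < N then y i else z (i - N)"])
    show "\<forall>x\<in>A. (case (trunc N x, \<lambda>j. x (j + N)) of (y, z) \<Rightarrow> \<lambda>i. if i < N then y i else z (i - N)) = x"
      by (auto simp: trunc_nth)
    show "\<forall>p\<in>(Fix g \<inter> words N) \<times> (Fix h \<inter> words n). (trunc N (case p of (y, z) \<Rightarrow> \<lambda>i. if i < N then y i else z (i - N)),
            \<lambda>j. (case p of (y, z) \<Rightarrow> \<lambda>i. if i < N then y i else z (i - N)) (j + N)) = p"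
    proof
      fix p assume "p \<in> (Fix g \<inter> words N) \<times> (Fix h \<inter> words n)"
      then obtain y z where p: "p = (y, z)" and "y \<in> words N" by blast
      then have "trunc N (\<lambda>i. if i < N then y i else z (i - N)) = y"
        using words_nth by (auto simp: trunc_def)
      then show "(trunc N (case p of (y, z) \<Rightarrow> \<lambda>i. if i < N then y i else z (i - N)),
            \<lambda>j. (case p of (y, z) \<Rightarrow> \<lambda>i. if i < N then y i else z (i - N)) (j + N)) = p"
        by (simp add: p)
    qed
    show "(\<lambda>x. (trunc N x, \<lambda>j. x (j + N))) ` A \<subseteq> (Fix g \<inter> words N) \<times> (Fix h \<inter> words n)"
      unfolding A_def Fix_comp_shift_by[OF g]
      by (auto simp: cyl_trunc_iff[OF cyl_Fix[OF g]]) (auto simp: words_def)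
    show "(\<lambda>(y, z) i. if i < N then y i else z (i - N)) ` ((Fix g \<inter> words N) \<times> (Fix h \<inter> words n)) \<subseteq> A"
    proof clarify
      fix y z assume *: "y \<in> Fix g" "y \<in> words N" "z \<in> Fix h" "z \<in> words n"
      define x where "x = (\<lambda>i. if i < N then y i else z (i - N))"
      have "x \<in> Fix g" using *(1) cylD[OF cyl_Fix[OF g], of x y] by (simp add: x_def)
      moreover have "(\<lambda>j. x (j + N)) = z" by (simp add: x_def)
      moreover have "x \<in> words (N + n)" using * by (auto simp: words_def x_def)
      ultimately show "(\<lambda>i. if i < N then y i else z (i - N)) \<in> A" unfolding x_def[symmetric] using * by (simp add: A_def Fix_comp_shift_by[OF g])
    qed
  qed
  then have "card A = card (Fix g \<inter> words N) * card (Fix h \<inter> words n)"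
    by (simp only: bij_betw_same_card card_cartesian_product)
  then show ?thesis
    by (simp add: fixm_eq[OF g] fixm_eq[OF h] fixm_eq[OF gh] A_def[symmetric] power_add)
qed

section \<open>Values of the fixed point measure\<close>

lemma prob_space_mu: "prob_space mu"
  unfolding mu_def by (rule prob_space_PiM) (rule measure_pmf.prob_space_axioms)

lemma fixm_id [simp]: "fixm id = 1"
  using fixm_eq[OF S2_id[of 0]] by (simp add: Fix_def card_words)

lemma fixm_bounds: "0 \<le> fixm g" "fixm g \<le> 1"
  using prob_space.prob_le_1[OF prob_space_mu] by (auto simp: fixm_def)

lemma fixm_shift_by: "h \<in> S2inf \<Longrightarrow> fixm (shift_by N h) = fixm h"
  using fixm_comp_shift_by[OF S2_id] by simp

lemma fixm_inv: "g \<in> S2inf \<Longrightarrow> fixm (inv g) = fixm g"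
  by (simp add: fixm_def Fix_def inv_Fix_iff)

definition atoms :: "nat \<Rightarrow> seq set \<Rightarrow> seq set" where
  "atoms n S = trunc n -` S"

lemma cyl_atoms: "cyl n (atoms n S)"
  unfolding atoms_def by (rule cyl_trunc_vimage)

lemma measure_atoms: "S \<subseteq> words n \<Longrightarrow> measure mu (atoms n S) = card S / 2 ^ n"
proof -
  assume S: "S \<subseteq> words n"
  then have "atoms n S \<inter> words n = S" by (auto simp: atoms_def trunc_words)
  then show ?thesis by (simp add: measure_mu_cyl[OF cyl_atoms])
qed

lemma measure_mu_Compl: "cyl n A \<Longrightarrow> measure mu (- A) = 1 - measure mu A"
proof -
  assume A: "cyl n A"
  have "space mu = UNIV" by (simp add: mu_def space_PiM)
  then show ?thesis
    using prob_space.prob_compl[OF prob_space_mu sets_mu_cyl[OF A]] by (simp add: Compl_eq_Diff_UNIV)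
qed

lemma fixm_flip: "cyl n A \<Longrightarrow> fixm (flip A k) = 1 - measure mu A"
  by (simp add: fixm_def Fix_flip measure_mu_Compl)

definition dyadics :: "real set" where
  "dyadics = {real k / 2 ^ n | k n. k \<le> 2 ^ n}"

text \<open>A flip on \<open>2 ^ n - k\<close> words fixes a set of mass \<open>k / 2 ^ n\<close>.
  An involution as witness is what the splitting by (1 + h) / 2 and (1 - h) / 2 calls for.\<close>

lemma dyadic_involution:
  assumes "x \<in> dyadics"
  shows "\<exists>h\<in>S2inf. h \<circ> h = id \<and> fixm h = x"
proof -
  obtain k n where x: "x = real k / 2 ^ n" and k: "k \<le> 2 ^ n"
    using assms unfolding dyadics_def by blast
  obtain S where S: "S \<subseteq> words n" "card S = 2 ^ n - k"
    using obtain_subset_with_card_n[of "2 ^ n - k" "words n"] by (auto simp: card_words)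
  have "fixm (flip (atoms n S) n) = x"
    using S k by (simp add: fixm_flip[OF cyl_atoms] measure_atoms x of_nat_diff field_simps)
  then show ?thesis
    using flip_S2inf[OF cyl_atoms order_refl] flip_twice[OF cyl_atoms order_refl] by blast
qed

lemma fixm_dyadic: "g \<in> S2inf \<Longrightarrow> fixm g \<in> dyadics"
proof -
  assume "g \<in> S2inf"
  then obtain n where n: "g \<in> S2 n" unfolding S2inf_def by blast
  have "card (Fix g \<inter> words n) \<le> 2 ^ n" using card_mono[OF finite_words[of n], of "Fix g \<inter> words n"] by (simp add: card_words)
  then show ?thesis unfolding fixm_eq[OF n] dyadics_def by blast
qed

section \<open>Nonnegative differences of the profile\<close>

text \<open>The \<open>m\<close>-fold backward difference with step \<open>p\<close>; it samples
  \<open>f\<close> at \<open>x\<close>, \<open>x - p\<close>, ..., \<open>x - m * p\<close>.\<close>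

primrec nabla :: "nat \<Rightarrow> real \<Rightarrow> (real \<Rightarrow> real) \<Rightarrow> real \<Rightarrow> real" where
  "nabla 0 p f x = f x"
| "nabla (Suc m) p f x = nabla m p f x - nabla m p f (x - p)"

text \<open>Positive definiteness on the semilattice of clopen sets under union. Sets stand for
  moved points, so the product of two projections corresponds to a union. Lists of weighted sets
  allow repetitions and can be concatenated.\<close>

definition union_psd :: "nat \<Rightarrow> (seq set \<Rightarrow> real) \<Rightarrow> bool" where
  "union_psd n G \<longleftrightarrow> (\<forall>xs. (\<forall>p\<in>set xs. cyl n (snd p)) \<longrightarrow>
     0 \<le> (\<Sum>p\<leftarrow>xs. \<Sum>q\<leftarrow>xs. fst p * fst q * G (snd p \<union> snd q)))"

text \<open>Evaluate the form at the combination in which every \<open>A\<close> is replaced by \<open>A - (A \<union> E)\<close>: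
  the terms starting from some \<open>A \<union> E\<close> cancel.\<close>

lemma union_psd_diff:
  assumes G: "union_psd n G" and E: "cyl n E"
  shows "union_psd n (\<lambda>A. G A - G (A \<union> E))"
  unfolding union_psd_def
proof (intro allI impI)
  fix xs :: "(real \<times> seq set) list" assume xs: "\<forall>p\<in>set xs. cyl n (snd p)"
  define \<theta> where "\<theta> p = (- fst p, snd p \<union> E)" for p :: "real \<times> seq set"
  define ys where "ys = xs @ map \<theta> xs"
  have ys: "\<forall>p\<in>set ys. cyl n (snd p)" using xs E by (auto simp: ys_def \<theta>_def cyl_Un)
  have inner: "(\<Sum>q\<leftarrow>ys. c * fst q * G (A \<union> snd q))
      = (\<Sum>q\<leftarrow>xs. c * fst q * (G (A \<union> snd q) - G (A \<union> snd q \<union> E)))" for c A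
    unfolding ys_def map_append sum_list_append map_map o_def sum_list_addf[symmetric]
    by (simp add: \<theta>_def algebra_simps Un_assoc)
  have second: "(\<Sum>q\<leftarrow>ys. fst (\<theta> p) * fst q * G (snd (\<theta> p) \<union> snd q)) = 0" for p
  proof -
    have "snd (\<theta> p) \<union> B \<union> E = snd (\<theta> p) \<union> B" for B by (auto simp: \<theta>_def)
    then show ?thesis by (simp add: inner)
  qed
  have "0 \<le> (\<Sum>p\<leftarrow>ys. \<Sum>q\<leftarrow>ys. fst p * fst q * G (snd p \<union> snd q))"
    using G ys unfolding union_psd_def by blast
  also have "\<dots> = (\<Sum>p\<leftarrow>xs. \<Sum>q\<leftarrow>ys. fst p * fst q * G (snd p \<union> snd q))"
  proof -
    have "(\<Sum>p\<leftarrow>ys. H p) = (\<Sum>p\<leftarrow>xs. H p) + (\<Sum>p\<leftarrow>xs. H (\<theta> p))" for H :: "real \<times> seq set \<Rightarrow> real"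
      by (simp add: ys_def o_def)
    note this[of "\<lambda>p. \<Sum>q\<leftarrow>ys. fst p * fst q * G (snd p \<union> snd q)", unfolded second]
    then show ?thesis by simp
  qed
  also have "\<dots> = (\<Sum>p\<leftarrow>xs. \<Sum>q\<leftarrow>xs. fst p * fst q * (G (snd p \<union> snd q) - G (snd p \<union> snd q \<union> E)))"
    unfolding inner ..
  finally show "0 \<le> (\<Sum>p\<leftarrow>xs. \<Sum>q\<leftarrow>xs. fst p * fst q * (G (snd p \<union> snd q) - G (snd p \<union> snd q \<union> E)))" .
qed

context character
begin

text \<open>By \<open>char_fixm_cong\<close> the chosen element does not matter. Off
  \<open>dyadics\<close> the value is unspecified.\<close>

definition profile :: "real \<Rightarrow> real" where
  "profile u = Re (ch (SOME g. g \<in> S2inf \<and> fixm g = u))"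

text \<open>An element and its inverse have the same fixed points, so \<open>char_inv\<close> makes
  the value equal to its conjugate.\<close>

lemma char_eq_profile: assumes g: "g \<in> S2inf" shows "ch g = of_real (profile (fixm g))"
proof -
  have "(SOME h. h \<in> S2inf \<and> fixm h = fixm g) \<in> S2inf \<and> fixm (SOME h. h \<in> S2inf \<and> fixm h = fixm g) = fixm g"
    by (rule someI[of _ g]) (simp add: g)
  then have "profile (fixm g) = Re (ch g)"
    unfolding profile_def using char_fixm_cong g by metis
  moreover have "cnj (ch g) = ch g"
    using char_inv[OF g] char_fixm_cong[OF S2inf_inv[OF g] g] fixm_inv[OF g] by simp
  then have "Im (ch g) = 0" by (simp add: complex_eq_iff)
  ultimately show ?thesis by (simp add: complex_eq_iff)
qed

lemma profile_one [simp]: "profile 1 = 1"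
  using char_eq_profile[OF S2inf_id] by simp

text \<open>Replace each set by \<open>L\<close> flips at different far coordinates. Flips at
  different coordinates compose to move the union, flips at the same coordinate the symmetric
  difference, so the form equals \<open>L * ((L - 1) * S + R)\<close>. As this is nonnegative for
  every \<open>L\<close>, so is \<open>S\<close>.\<close>

lemma profile_union_psd: "union_psd n (\<lambda>A. profile (1 - measure mu A))"
  unfolding union_psd_def
proof (intro allI impI)
  fix xs :: "(real \<times> seq set) list" assume xs: "\<forall>p\<in>set xs. cyl n (snd p)"
  define m where "m = length xs"
  define c where "c i = fst (xs ! i)" for i
  define A where "A i = snd (xs ! i)" for i
  have A: "cyl n (A i)" if "i < m" for i using xs that by (simp add: A_def m_def)
  define S where "S = (\<Sum>i<m. \<Sum>j<m. c i * c j * profile (1 - measure mu (A i \<union> A j)))"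
  define R where "R = (\<Sum>i<m. \<Sum>j<m. c i * c j * profile (1 - measure mu ((A i - A j) \<union> (A j - A i))))"
  have key: "0 \<le> (real L - 1) * S + R" if L: "L > 0" for L :: nat
  proof -
    define g where "g p = flip (A (fst p)) (n + snd p)" for p
    define V where "V i j k l = profile (if k = l then 1 - measure mu ((A i - A j) \<union> (A j - A i)) else 1 - measure mu (A i \<union> A j))"
      for i j and k l :: nat
    have val: "ch (g (i, k) \<circ> inv (g (j, l))) = of_real (V i j k l)" if ij: "i < m" "j < m" for i j k l
    proof -
      define N where "N = Suc (n + k + l)"
      have t: "twist n N (\<lambda>x a. a = n + k \<and> x \<in> A i)" "twist n N (\<lambda>x a. a = n + l \<and> x \<in> A j)"
        using A ij by (auto intro!: twist_flip simp: N_def)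
      have inv: "inv (g (j, l)) = g (j, l)"
        unfolding g_def by (rule involution_inv, rule flip_twice[OF A]) (use ij in auto)
      define w where "w = (\<lambda>x a. (a = n + k \<and> x \<in> A i) \<noteq> (a = n + l \<and> x \<in> A j))"
      have eq: "g (i, k) \<circ> inv (g (j, l)) = wflip w"
        unfolding inv unfolding g_def flip_def w_def using wflip_comp[OF t] by simp
      have w: "wflip w \<in> S2inf"
        unfolding w_def by (rule S2_subset[OF wflip_S2[OF twist_diff[OF t]]]) (simp add: N_def)
      have "Fix (wflip w) = - (if k = l then (A i - A j) \<union> (A j - A i) else A i \<union> A j)"
        unfolding Fix_wflip w_def by auto
      moreover have "cyl n ((A i - A j) \<union> (A j - A i))" "cyl n (A i \<union> A j)"
        unfolding Diff_eq using A ij by (auto intro!: cyl_Un cyl_Int cyl_Compl)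
      ultimately have "fixm (wflip w) = 1 - measure mu (if k = l then (A i - A j) \<union> (A j - A i) else A i \<union> A j)"
        using measure_mu_Compl[of n "if k = l then (A i - A j) \<union> (A j - A i) else A i \<union> A j"]
        unfolding fixm_def by presburger
      then have "profile (fixm (wflip w)) = V i j k l" by (simp add: V_def)
      then show ?thesis using char_eq_profile[OF w] by (simp add: eq)
    qed
    have "0 \<le> Re (\<Sum>p\<in>{..<m} \<times> {..<L}. \<Sum>q\<in>{..<m} \<times> {..<L}.
        cnj (of_real (c (fst p))) * ch (g p \<circ> inv (g q)) * of_real (c (fst q)))"
    proof (rule pos_def(2))
      fix p assume "p \<in> {..<m} \<times> {..<L}"
      then show "g p \<in> S2inf" unfolding g_def by (intro flip_S2inf[OF A]) auto
    qed simp
    also have "\<dots> = (\<Sum>p\<in>{..<m} \<times> {..<L}. \<Sum>q\<in>{..<m} \<times> {..<L}. c (fst p) * c (fst q) * V (fst p) (fst q) (snd p) (snd q))"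
      unfolding Re_sum by (intro sum.cong refl) (auto simp: val)
    also have "\<dots> = (\<Sum>i<m. \<Sum>k<L. \<Sum>j<m. \<Sum>l<L. c i * c j * V i j k l)"
      unfolding sum.cartesian_product' by simp
    also have "\<dots> = (\<Sum>i<m. \<Sum>j<m. \<Sum>k<L. \<Sum>l<L. c i * c j * V i j k l)"
      by (rule sum.cong[OF refl]) (rule sum.swap)
    also have "\<dots> = (\<Sum>i<m. \<Sum>j<m. real L * ((real L - 1) * (c i * c j * profile (1 - measure mu (A i \<union> A j)))
        + c i * c j * profile (1 - measure mu ((A i - A j) \<union> (A j - A i)))))"
    proof (intro sum.cong refl)
      fix i j
      have "(\<Sum>l<L. c i * c j * V i j k l) = (real L - 1) * (c i * c j * profile (1 - measure mu (A i \<union> A j)))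
        + c i * c j * profile (1 - measure mu ((A i - A j) \<union> (A j - A i)))" if k: "k < L" for k
      proof -
        have "(\<Sum>l<L. c i * c j * V i j k l) = c i * c j * V i j k k + (\<Sum>l\<in>{..<L} - {k}. c i * c j * V i j k l)"
          using k by (simp add: sum.remove[of "{..<L}" k])
        also have "(\<Sum>l\<in>{..<L} - {k}. c i * c j * V i j k l) = (\<Sum>l\<in>{..<L} - {k}. c i * c j * profile (1 - measure mu (A i \<union> A j)))"
          by (intro sum.cong refl) (auto simp: V_def)
        also have "\<dots> = (real L - 1) * (c i * c j * profile (1 - measure mu (A i \<union> A j)))"
          using k by (simp add: card_Diff_singleton of_nat_diff)
        finally show ?thesis by (simp add: V_def)
      qed
      then show "(\<Sum>k<L. \<Sum>l<L. c i * c j * V i j k l) = real L * ((real L - 1) * (c i * c j * profile (1 - measure mu (A i \<union> A j)))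
        + c i * c j * profile (1 - measure mu ((A i - A j) \<union> (A j - A i))))" by simp
    qed
    also have "\<dots> = real L * ((real L - 1) * S + R)"
      unfolding S_def R_def by (simp add: sum.distrib sum_distrib_left distrib_left)
    finally show ?thesis using L by (simp add: zero_le_mult_iff)
  qed
  have "0 \<le> S"
  proof (rule ccontr)
    assume "\<not> 0 \<le> S"
    then have "0 < - S" by simp
    then obtain L :: nat where "R < real L * (- S)" using reals_Archimedean3 by blast
    \<comment> \<open>In \<open>key\<close> the coefficient of \<open>S\<close> is one less than the
      number of copies.\<close>
    with key[of "Suc L"] show False by simp
  qed
  also have "S = (\<Sum>p\<leftarrow>xs. \<Sum>q\<leftarrow>xs. fst p * fst q * profile (1 - measure mu (snd p \<union> snd q)))"
    unfolding S_def c_def A_def m_def by (simp add: sum_list_sum_nth atLeast0LessThan)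
  finally show "0 \<le> (\<Sum>p\<leftarrow>xs. \<Sum>q\<leftarrow>xs. fst p * fst q * profile (1 - measure mu (snd p \<union> snd q)))" .
qed

text \<open>Start from a union of \<open>j\<close> atoms and take \<open>m\<close> differences along
  further distinct atoms. Each new atom lowers the fixed measure by \<open>1 / 2 ^ n\<close>, so the
  result is an iterated difference of \<open>profile\<close>; testing the form on a one-element list
  shows that it is nonnegative.\<close>

lemma nabla_profile_nonneg:
  assumes "j + m \<le> 2 ^ n"
  shows "0 \<le> nabla m (1 / 2 ^ n) profile (1 - real j / 2 ^ n)"
proof -
  obtain e where e: "bij_betw e {..<2 ^ n :: nat} (words n)"
    using ex_bij_betw_nat_finite[OF finite_words[of n]] by (auto simp: card_words atLeast0LessThan)
  define E where "E i = atoms n {e (j + i)}" for i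
  define G where "G = rec_nat (\<lambda>A. profile (1 - measure mu A)) (\<lambda>k G A. G A - G (A \<union> E k))"
  have G: "G 0 = (\<lambda>A. profile (1 - measure mu A))" "G (Suc k) = (\<lambda>A. G k A - G k (A \<union> E k))" for k
    by (simp_all add: G_def)
  have psd: "union_psd n (G k)" for k
    by (induction k) (auto simp: G profile_union_psd E_def intro!: union_psd_diff cyl_atoms)
  have einj: "e i = e i' \<longleftrightarrow> i = i'" if "i < 2 ^ n" "i' < 2 ^ n" for i i'
    using e that unfolding bij_betw_def inj_on_def by blast
  have eT: "e i \<in> words n" if "i < 2 ^ n" for i using bij_betwE[OF e] that by simp
  have "G k (atoms n S) = nabla k (1 / 2 ^ n) profile (1 - real (card S) / 2 ^ n)"
    if "k \<le> m" "S \<subseteq> words n" "\<And>i. i < k \<Longrightarrow> e (j + i) \<notin> S" for k S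
    using that
  proof (induction k arbitrary: S)
    case 0
    then show ?case by (simp add: G measure_atoms)
  next
    case (Suc k)
    define S' where "S' = insert (e (j + k)) S"
    have jk: "j + k < 2 ^ n" using assms Suc.prems(1) by simp
    have S': "S' \<subseteq> words n" using Suc.prems(2) eT[OF jk] by (simp add: S'_def)
    have "finite S" using Suc.prems(2) finite_words finite_subset by blast
    then have c: "card S' = Suc (card S)" using Suc.prems(3)[of k] by (simp add: S'_def)
    have "e (j + i) \<notin> S'" if "i < k" for i
      using that jk einj[of "j + i" "j + k"] Suc.prems(3)[of i] by (simp add: S'_def)
    then have "G k (atoms n S') = nabla k (1 / 2 ^ n) profile (1 - real (card S') / 2 ^ n)"
      using Suc.prems(1) S' by (intro Suc.IH) auto
    moreover have "atoms n S \<union> E k = atoms n S'" by (auto simp: atoms_def E_def S'_def)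
    moreover have "G k (atoms n S) = nabla k (1 / 2 ^ n) profile (1 - real (card S) / 2 ^ n)"
      using Suc.prems by (intro Suc.IH) auto
    moreover have "1 - real (card S') / 2 ^ n = 1 - real (card S) / 2 ^ n - 1 / 2 ^ n"
      unfolding c by (simp add: field_simps)
    ultimately show ?case by (simp add: G)
  qed
  note this[of m "e ` {..<j}"]
  moreover have "e ` {..<j} \<subseteq> words n" using eT assms by auto
  moreover have "e (j + i) \<notin> e ` {..<j}" if "i < m" for i
  proof
    assume "e (j + i) \<in> e ` {..<j}"
    then obtain i' where "i' < j" "e (j + i) = e i'" by auto
    with einj[of "j + i" i'] that assms show False by simp
  qed
  moreover have "card (e ` {..<j}) = j"
    using e assms by (subst card_image) (auto simp: bij_betw_def intro: inj_on_subset)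
  ultimately have "G m (atoms n (e ` {..<j})) = nabla m (1 / 2 ^ n) profile (1 - real j / 2 ^ n)" by simp
  moreover have "0 \<le> G m (atoms n (e ` {..<j}))"
    using psd[of m, unfolded union_psd_def, rule_format, of "[(1, atoms n (e ` {..<j}))]"]
    by (simp add: cyl_atoms)
  ultimately show ?thesis by simp
qed

lemma profile_nonneg: "x \<in> dyadics \<Longrightarrow> 0 \<le> profile x"
proof -
  assume "x \<in> dyadics"
  then obtain k n where "x = real k / 2 ^ n" "k \<le> 2 ^ n" unfolding dyadics_def by blast
  then show ?thesis using nabla_profile_nonneg[of "2 ^ n - k" 0 n] by (simp add: of_nat_diff diff_divide_distrib)
qed

end

section \<open>Multiplicative functions with nonnegative differences\<close>

lemma nabla_cong:
  "(\<And>i. i \<le> m \<Longrightarrow> f (x - real i * p) = g (x - real i * p)) \<Longrightarrow> nabla m p f x = nabla m p g x"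
proof (induction m arbitrary: x)
  case 0
  then show ?case by simp
next
  case (Suc m)
  have "nabla m p f x = nabla m p g x" using Suc.prems by (intro Suc.IH) simp
  moreover have "nabla m p f (x - p) = nabla m p g (x - p)"
  proof (rule Suc.IH)
    fix i assume "i \<le> m"
    with Suc.prems[of "Suc i"] show "f (x - p - real i * p) = g (x - p - real i * p)"
      by (simp add: algebra_simps)
  qed
  ultimately show ?case by simp
qed

lemma nabla_deriv:
  assumes "\<And>y. 0 < y \<Longrightarrow> (g has_real_derivative g' y) (at y)" and "real m * p < x" and "0 < p"
  shows "(nabla m p g has_real_derivative nabla m p g' x) (at x)"
  using assms(2)
proof (induction m arbitrary: x)
  case 0
  then have "0 < x" by simp
  moreover have "nabla 0 p h = h" for h by (rule ext) simp
  ultimately show ?case using assms(1) by simp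
next
  case (Suc m)
  have 1: "(nabla m p g has_real_derivative nabla m p g' x) (at x)"
    using Suc.prems \<open>0 < p\<close> by (intro Suc.IH) (simp add: algebra_simps)
  have 2: "(nabla m p g has_real_derivative nabla m p g' (x - p)) (at (x - p))"
    using Suc.prems by (intro Suc.IH) (simp add: algebra_simps)
  have "((\<lambda>y. nabla m p g (y - p)) has_real_derivative nabla m p g' (x - p)) (at x)"
    using DERIV_shift[of "nabla m p g" "nabla m p g' (x - p)" x "- p"] 2 by simp
  from DERIV_diff[OF 1 this] have "((\<lambda>y. nabla m p g y - nabla m p g (y - p)) has_real_derivative nabla (Suc m) p g' x) (at x)"
    by simp
  moreover have "nabla (Suc m) p g = (\<lambda>y. nabla m p g y - nabla m p g (y - p))" by (rule ext) simp
  ultimately show ?case by (simp only:)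
qed

lemma nabla_scale: "nabla m p (\<lambda>y. c * g y) x = c * nabla m p g x"
  by (induction m arbitrary: x) (simp_all add: right_diff_distrib)

text \<open>By the mean value theorem one difference may be traded for a derivative at some \<xi>
  above \<open>x - p\<close>, which produces the factor \<beta> and lowers the exponent by one. The
  bound on \<open>x\<close> keeps all sample points positive, where \<open>powr\<close> is
  differentiable.\<close>

lemma nabla_powr_sign:
  assumes "real m * p < x" "0 < p"
  shows "\<exists>r>0. nabla m p (\<lambda>y. y powr \<beta>) x = r * (\<Prod>i<m. \<beta> - real i)"
  using assms(1)
proof (induction m arbitrary: x \<beta>)
  case 0
  then show ?case by auto
next
  case (Suc m)
  define G where "G = nabla m p (\<lambda>y. y powr \<beta>)"
  define G' where "G' = nabla m p (\<lambda>y. \<beta> * y powr (\<beta> - 1))"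
  have der: "(G has_real_derivative G' y) (at y)" if "x - p \<le> y" for y
    unfolding G_def G'_def
    by (rule nabla_deriv) (use that Suc.prems assms(2) in \<open>auto intro!: has_real_derivative_powr simp: algebra_simps\<close>)
  obtain \<xi> where \<xi>: "x - p < \<xi>" "G x - G (x - p) = (x - (x - p)) * G' \<xi>"
    using MVT2[of "x - p" x G G'] der assms(2) by auto
  have "real m * p < \<xi>" using \<xi>(1) Suc.prems by (simp add: algebra_simps)
  then obtain r where r: "r > 0" "nabla m p (\<lambda>y. y powr (\<beta> - 1)) \<xi> = r * (\<Prod>i<m. \<beta> - 1 - real i)"
    using Suc.IH by blast
  have "nabla (Suc m) p (\<lambda>y. y powr \<beta>) x = p * (\<beta> * (r * (\<Prod>i<m. \<beta> - 1 - real i)))"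
    using \<xi>(2) r(2) by (simp add: G_def G'_def nabla_scale)
  also have "\<dots> = (p * r) * (\<Prod>i<Suc m. \<beta> - real i)"
    unfolding prod.lessThan_Suc_shift by (simp add: algebra_simps)
  finally show ?case using r(1) assms(2) by (intro exI[of _ "p * r"]) simp
qed

text \<open>A fixed constant disappears on taking \<open>k\<close>-th roots, so comparing all powers
  up to a constant is enough.\<close>

lemma le_if_powers_le:
  fixes p q :: real
  assumes "\<And>k. p ^ k \<le> C * q ^ k" and "0 < q"
  shows "p \<le> q"
proof (rule ccontr)
  assume "\<not> p \<le> q"
  with assms(2) have "1 < p / q" by simp
  then obtain k where "C < (p / q) ^ k" using real_arch_pow by blast
  then have "C * q ^ k < p ^ k" using assms(2) by (simp add: power_divide pos_less_divide_eq)
  with assms(1)[of k] show False by linarith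
qed

lemma between_powers_of_half:
  fixes t :: real assumes "0 < t" "t \<le> 1"
  shows "\<exists>j. (1/2) ^ Suc j \<le> t \<and> t \<le> (1/2) ^ j"
proof -
  define n where "n = (LEAST n. (1/2) ^ n \<le> t)"
  obtain n0 where "(1/2::real) ^ n0 < t" using real_arch_pow_inv[OF assms(1), of "1/2"] by auto
  then have n: "(1/2) ^ n \<le> t" unfolding n_def using LeastI[of "\<lambda>n. (1/2) ^ n \<le> t" n0] by simp
  show ?thesis
  proof (cases n)
    case 0
    with n assms show ?thesis by (intro exI[of _ 0]) auto
  next
    case (Suc j)
    then have "\<not> (1/2) ^ j \<le> t" using not_less_Least[of j "\<lambda>n. (1/2) ^ n \<le> t"] by (simp add: n_def)
    with n Suc show ?thesis by (intro exI[of _ j]) auto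
  qed
qed

lemma dyadics_bounds: "x \<in> dyadics \<Longrightarrow> 0 \<le> x \<and> x \<le> 1"
proof -
  assume "x \<in> dyadics"
  then obtain k n :: nat where "x = real k / 2 ^ n" and k: "k \<le> 2 ^ n" unfolding dyadics_def by blast
  moreover from k have "real k \<le> 2 ^ n" by (metis of_nat_le_iff of_nat_numeral of_nat_power)
  ultimately show ?thesis by simp
qed

lemma dyadicsI: "k \<le> 2 ^ n \<Longrightarrow> real k / 2 ^ n \<in> dyadics"
  unfolding dyadics_def by blast

lemma dyadics_0: "0 \<in> dyadics" and dyadics_1: "1 \<in> dyadics" and dyadics_half_power: "(1/2) ^ n \<in> dyadics"
  using dyadicsI[of 0 0] dyadicsI[of 1 0] dyadicsI[of 1 n] by (simp_all add: power_one_over)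

lemma dyadics_mult: "x \<in> dyadics \<Longrightarrow> y \<in> dyadics \<Longrightarrow> x * y \<in> dyadics"
proof -
  assume "x \<in> dyadics" "y \<in> dyadics"
  then obtain k n l m where "x = real k / 2 ^ n" "k \<le> 2 ^ n" "y = real l / 2 ^ m" "l \<le> 2 ^ m"
    unfolding dyadics_def by blast
  then show ?thesis using dyadicsI[of "k * l" "n + m"] by (simp add: power_add mult_le_mono)
qed

lemma dyadics_power: "x \<in> dyadics \<Longrightarrow> x ^ k \<in> dyadics"
  by (induction k) (simp_all add: dyadics_1 dyadics_mult)

section \<open>The power law for multiplicative profiles\<close>

locale multiplicative_profile =
  fixes f :: "real \<Rightarrow> real"
  assumes one: "f 1 = 1"
    and mult: "\<And>x y. x \<in> dyadics \<Longrightarrow> y \<in> dyadics \<Longrightarrow> f (x * y) = f x * f y"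
    and nabla_nonneg: "\<And>j m n. j + m \<le> 2 ^ n \<Longrightarrow> 0 \<le> nabla m (1 / 2 ^ n) f (1 - real j / 2 ^ n)"
begin

lemma nonneg: "x \<in> dyadics \<Longrightarrow> 0 \<le> f x"
proof -
  assume "x \<in> dyadics"
  then obtain k n where "x = real k / 2 ^ n" "k \<le> 2 ^ n" unfolding dyadics_def by blast
  then show ?thesis using nabla_nonneg[of "2 ^ n - k" 0 n] by (simp add: of_nat_diff diff_divide_distrib)
qed

text \<open>First differences compare neighbours at one level; two arbitrary dyadics are brought to
  the common denominator \<open>2 ^ (n + m)\<close>.\<close>

lemma mono: assumes "x \<in> dyadics" "y \<in> dyadics" "x \<le> y" shows "f x \<le> f y"
proof -
  have next_le: "f (real i / 2 ^ N) \<le> f (real (Suc i) / 2 ^ N)" if "Suc i \<le> 2 ^ N" for i N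
  proof -
    have r: "real (2 ^ N - Suc i) = 2 ^ N - real (Suc i)" using that by (simp add: of_nat_diff)
    have A: "1 - real (2 ^ N - Suc i) / 2 ^ N = real (Suc i) / 2 ^ N"
      unfolding r by (simp add: field_simps)
    have B: "real (Suc i) / 2 ^ N - 1 / 2 ^ N = real i / 2 ^ N" by (simp add: field_simps)
    have "0 \<le> nabla 1 (1 / 2 ^ N) f (1 - real (2 ^ N - Suc i) / 2 ^ N)"
      using that by (intro nabla_nonneg) simp
    then show ?thesis unfolding A One_nat_def nabla.simps B by simp
  qed
  have le: "f (real i / 2 ^ N) \<le> f (real i' / 2 ^ N)" if "i \<le> i'" "i' \<le> 2 ^ N" for i i' N
    using that
  proof (induction i' rule: dec_induct)
    case (step j)
    then show ?case using next_le[of j N] by simp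
  qed simp
  obtain k n l m where x: "x = real k / 2 ^ n" "k \<le> 2 ^ n" and y: "y = real l / 2 ^ m" "l \<le> 2 ^ m"
    using assms unfolding dyadics_def by blast
  have x': "x = real (k * 2 ^ m) / 2 ^ (n + m)" and y': "y = real (l * 2 ^ n) / 2 ^ (n + m)"
    using x y by (simp_all add: power_add)
  have "real (k * 2 ^ m) \<le> real (l * 2 ^ n)"
    using assms(3) unfolding x' y' by (simp add: divide_le_cancel)
  then have "k * 2 ^ m \<le> l * 2 ^ n" by linarith
  moreover have "l * 2 ^ n \<le> 2 ^ (n + m)" using y by (simp add: power_add)
  ultimately show ?thesis unfolding x' y' by (rule le)
qed

lemma le_1: "x \<in> dyadics \<Longrightarrow> f x \<le> 1"
  using mono[OF _ dyadics_1] dyadics_bounds one by simp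

lemma power: "x \<in> dyadics \<Longrightarrow> f (x ^ k) = f x ^ k"
  by (induction k) (simp_all add: one mult dyadics_power)

lemma half_powers: "f ((1/2) ^ k) = f (1/2) ^ k"
  using power[of "1/2" k] dyadics_half_power[of 1] by simp

text \<open>The exponent is fixed by the value at 1/2. No continuity is available, so
  \<open>x ^ k\<close> is caught between consecutive powers of 1/2: by monotonicity
  \<open>f x ^ k\<close> and \<open>(x powr \<beta>) ^ k\<close> then lie between the same two
  powers of \<open>f (1/2)\<close>. Their ratio is bounded independently of \<open>k\<close>, and
  \<open>le_if_powers_le\<close> applies in both directions.\<close>

lemma power_law_real:
  assumes a: "0 < f (1/2)" "f (1/2) < 1"
  defines "\<beta> \<equiv> - log 2 (f (1/2))"
  shows "0 < \<beta>" and "x \<in> dyadics \<Longrightarrow> 0 < x \<Longrightarrow> f x = x powr \<beta>" and "f 0 = 0"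
proof -
  let ?a = "f (1/2)"
  show b: "0 < \<beta>" using a by (simp add: \<beta>_def)
  have "(1/2) powr \<beta> = ?a"
    using a by (simp add: \<beta>_def powr_minus_divide powr_divide)
  then have hp: "((1/2) ^ j) powr \<beta> = ?a ^ j" for j
    by (simp add: powr_power[symmetric] powr_realpow[symmetric] powr_powr mult.commute)
       (metis mult.commute powr_powr powr_realpow a(1) zero_less_divide_1_iff zero_less_numeral)
  have "f (0 * (1/2)) = f 0 * ?a"
    using mult[OF dyadics_0, of "1/2"] dyadics_half_power[of 1] by simp
  then show "f 0 = 0" using a by simp
  assume x: "x \<in> dyadics" "0 < x"
  have bd: "\<exists>j. ?a ^ Suc j \<le> f x ^ k \<and> f x ^ k \<le> ?a ^ j \<and> ?a ^ Suc j \<le> (x powr \<beta>) ^ k \<and> (x powr \<beta>) ^ k \<le> ?a ^ j" for k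
  proof -
    have "0 < x ^ k" "x ^ k \<le> 1" using x dyadics_bounds[of x] by (auto simp: power_le_one)
    then obtain j where j: "(1/2) ^ Suc j \<le> x ^ k" "x ^ k \<le> (1/2) ^ j"
      using between_powers_of_half by blast
    have "(x powr \<beta>) ^ k = (x ^ k) powr \<beta>"
      using x by (simp add: powr_realpow[symmetric] powr_powr mult.commute)
    then have "?a ^ Suc j \<le> (x powr \<beta>) ^ k" "(x powr \<beta>) ^ k \<le> ?a ^ j"
      using powr_mono2[of \<beta> "(1/2) ^ Suc j" "x ^ k"] powr_mono2[of \<beta> "x ^ k" "(1/2) ^ j"] b j x hp[of j] hp[of "Suc j"]
      by auto
    moreover have "?a ^ Suc j \<le> f x ^ k" "f x ^ k \<le> ?a ^ j"
      using mono[OF dyadics_half_power dyadics_power[OF x(1)] j(1)]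
        mono[OF dyadics_power[OF x(1)] dyadics_half_power j(2)] half_powers[of j] half_powers[of "Suc j"] power[OF x(1), of k]
      by simp_all
    ultimately show ?thesis by blast
  qed
  have fx: "0 < f x" using bd[of 1] a by (metis power_one_right zero_less_power less_le_trans)
  have close: "u \<le> 1 / ?a * v" if "?a ^ Suc j \<le> v" "u \<le> ?a ^ j" for u v j
  proof -
    have "?a * u \<le> ?a ^ Suc j" using that(2) a by simp
    with that(1) have "?a * u \<le> v" by linarith
    with a show ?thesis by (simp add: field_simps)
  qed
  show "f x = x powr \<beta>"
  proof (rule antisym)
    show "f x \<le> x powr \<beta>"
    proof (rule le_if_powers_le)
      show "f x ^ k \<le> 1 / ?a * (x powr \<beta>) ^ k" for k using bd[of k] close by blast
    qed (use x in simp)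
    show "x powr \<beta> \<le> f x"
    proof (rule le_if_powers_le)
      show "(x powr \<beta>) ^ k \<le> 1 / ?a * f x ^ k" for k using bd[of k] close by blast
    qed (rule fx)
  qed
qed

lemma exponent_nat:
  assumes a: "0 < f (1/2)" "f (1/2) < 1"
  shows "\<exists>k::nat. - log 2 (f (1/2)) = real k"
proof (rule ccontr)
  define \<beta> where "\<beta> = - log 2 (f (1/2))"
  assume "\<not> ?thesis"
  then have nk: "\<beta> \<noteq> real k" for k :: nat by (auto simp: \<beta>_def)
  note pl = power_law_real[OF a, folded \<beta>_def]
  define K where "K = nat \<lfloor>\<beta>\<rfloor>"
  have K: "real K < \<beta>" "\<beta> < real K + 1"
  proof -
    have "real K = of_int \<lfloor>\<beta>\<rfloor>" using pl(1) by (simp add: K_def)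
    then show "real K < \<beta>" "\<beta> < real K + 1" using nk[of K] by linarith+
  qed
  \<comment> \<open>With this order the product over \<open>i < m\<close> has exactly one negative
    factor, the last one, with \<open>i = K + 1\<close>.\<close>
  define m where "m = Suc (Suc K)"
  \<comment> \<open>A step this fine keeps all sample points \<open>1 - i / 2 ^ n\<close> with
    \<open>i \<le> m\<close> positive, where \<open>f\<close> agrees with the power
    function.\<close>
  obtain n where "m < 2 ^ n" using less_exp by blast
  define p where "p = 1 / (2::real) ^ n"
  have mp: "real m * p < 1"
    using of_nat_less_iff[of m "2 ^ n", where 'a = real] \<open>m < 2 ^ n\<close> by (simp add: p_def)
  have "0 \<le> nabla m p f 1"
    using nabla_nonneg[of 0 m n] \<open>m < 2 ^ n\<close> by (simp add: p_def)
  also have "nabla m p f 1 = nabla m p (\<lambda>y. y powr \<beta>) 1"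
  proof (rule nabla_cong)
    fix i assume i: "i \<le> m"
    have "1 - real i * p = real (2 ^ n - i) / 2 ^ n"
      using i \<open>m < 2 ^ n\<close> by (simp add: p_def of_nat_diff diff_divide_distrib)
    then have "1 - real i * p \<in> dyadics" using dyadicsI[of "2 ^ n - i" n] by simp
    moreover have "real i * p \<le> real m * p" using i by (simp add: p_def divide_right_mono)
    then have "0 < 1 - real i * p" using mp by linarith
    ultimately show "f (1 - real i * p) = (1 - real i * p) powr \<beta>" by (rule pl(2))
  qed
  finally have nn: "0 \<le> nabla m p (\<lambda>y. y powr \<beta>) 1" .
  obtain r where "r > 0" "nabla m p (\<lambda>y. y powr \<beta>) 1 = r * (\<Prod>i<m. \<beta> - real i)"
    using nabla_powr_sign[OF mp, of \<beta>] by (auto simp: p_def)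
  with nn have "0 \<le> (\<Prod>i<m. \<beta> - real i)" by (simp add: zero_le_mult_iff)
  moreover have "0 < (\<Prod>i<Suc K. \<beta> - real i)" using K by (intro prod_pos) auto
  moreover have "(\<Prod>i<m. \<beta> - real i) = (\<Prod>i<Suc K. \<beta> - real i) * (\<beta> - real (Suc K))"
    by (simp add: m_def)
  ultimately have "0 \<le> \<beta> - real (Suc K)" by (simp add: zero_le_mult_iff)
  with K show False by simp
qed

lemma power_law: "\<exists>\<alpha>. \<forall>x\<in>dyadics. f x = epow x \<alpha>"
proof -
  have half: "1/2 \<in> dyadics" using dyadics_half_power[of 1] by simp
  consider "f (1/2) = 0" | "f (1/2) = 1" | "0 < f (1/2)" "f (1/2) < 1"
    using nonneg[OF half] le_1[OF half] by linarith
  then show ?thesis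
  proof cases
    case 1
    have "f x = 0" if x: "x \<in> dyadics" "x \<noteq> 1" for x
    proof -
      have "x < 1" using dyadics_bounds[OF x(1)] x(2) by simp
      \<comment> \<open>Some power of \<open>x\<close> drops below 1/2, where \<open>f\<close>
        vanishes by monotonicity; by multiplicativity \<open>f\<close> vanishes at \<open>x\<close>
        too.\<close>
      then obtain k where "x ^ k < 1/2" using real_arch_pow_inv[of "1/2" x] by auto
      then have "f (x ^ k) \<le> 0" using mono[OF dyadics_power[OF x(1)] half, of k] 1 by simp
      then have "f x ^ k = 0" using nonneg[OF dyadics_power[OF x(1)], of k] power[OF x(1), of k] by simp
      then show ?thesis by (metis power_eq_0_iff)
    qed
    then show ?thesis using one by (intro exI[of _ \<infinity>]) (auto simp: epow_def)
  next
    case 2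
    \<comment> \<open>Multiplicativity and monotonicity would still permit a drop at 0. The second
      difference of step 1/2 at 1 excludes it and forces the convention that
      \<open>0 ^ 0 = 1\<close>.\<close>
    have "0 \<le> f 1 - f (1/2) - (f (1/2) - f 0)"
      using nabla_nonneg[of 0 2 1] by (simp add: numeral_2_eq_2)
    then have "1 \<le> f 0" using 2 one by simp
    then have "f x = 1" if "x \<in> dyadics" for x
      using mono[OF dyadics_0 that] le_1[OF that] dyadics_bounds[OF that] by simp
    then show ?thesis by (intro exI[of _ 0]) (auto simp: epow_def zero_enat_def)
  next
    case 3
    obtain k where k: "- log 2 (f (1/2)) = real k" using exponent_nat[OF 3] by blast
    note pl = power_law_real[OF 3, unfolded k]
    have "f x = x ^ k" if "x \<in> dyadics" for x
    proof (cases "x = 0")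
      case True
      then show ?thesis using pl(1,3) by simp
    next
      case False
      then have "0 < x" using dyadics_bounds[OF that] by simp
      then show ?thesis using pl(2)[OF that] by (simp add: powr_realpow)
    qed
    then show ?thesis by (intro exI[of _ "enat k"]) (auto simp: epow_def)
  qed
qed

end

section \<open>Indecomposable characters\<close>

context character
begin

text \<open>Up to normalisation this is \<open>g \<mapsto> ch (g (1 + e h) / 2)\<close> with \<open>h\<close> moved so far out that it commutes
  with \<open>g\<close>.\<close>

lemma twisted_character:
  assumes h: "h \<in> S2inf" "h \<circ> h = id" and e: "e * e = 1" and pos: "0 < 1 + e * profile (fixm h)"
  shows "is_character (\<lambda>g. of_real ((profile (fixm g) + e * profile (fixm g * fixm h)) / (1 + e * profile (fixm h))))"
    (is "is_character ?\<psi>")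
proof -
  define Z where "Z = complex_of_real (1 + e * profile (fixm h))"
  have Z: "Z \<noteq> 0" unfolding Z_def of_real_eq_0_iff using pos by simp
  define H where "H N = shift_by N h" for N
  have H: "H N \<in> S2inf" "H N \<circ> H N = id" for N
    using h shift_by_S2inf by (auto simp: H_def shift_by_comp shift_by_id)
  have Hinv: "inv (H N) = H N" for N by (rule involution_inv[OF H(2)])
  \<comment> \<open>The twisted value does not depend on how far \<open>h\<close> is moved, so
    \<open>N\<close> can be chosen afresh for any finite set of elements.\<close>
  have key: "?\<psi> g * Z = ch g + of_real e * ch (g \<circ> H N)" if "g \<in> S2 N" for g N
  proof -
    have "ch (g \<circ> H N) = of_real (profile (fixm g * fixm h))"
      using char_eq_profile[OF S2inf_comp[OF S2_subset[OF that] H(1)[of N]]] fixm_comp_shift_by[OF that h(1)]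
      by (simp add: H_def)
    then show ?thesis using char_eq_profile[OF S2_subset[OF that]] Z by (simp add: Z_def)
  qed
  have "?\<psi> (g1 \<circ> g2) = ?\<psi> (g2 \<circ> g1)" if g: "g1 \<in> S2inf" "g2 \<in> S2inf" for g1 g2
  proof -
    obtain n1 n2 where "\<forall>m\<ge>n1. g1 \<in> S2 m" "\<forall>m\<ge>n2. g2 \<in> S2 m"
      using g S2inf_level by presburger
    then obtain N where N: "g1 \<in> S2 N" "g2 \<in> S2 N" by (meson max.cobounded1 max.cobounded2)
    have "ch (g1 \<circ> g2 \<circ> H N) = ch (g1 \<circ> (H N \<circ> g2))"
      using shift_by_commute[OF N(2), of h] by (simp add: H_def o_assoc[symmetric])
    also have "\<dots> = ch ((H N \<circ> g2) \<circ> g1)" using g H by (intro central) auto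
    also have "\<dots> = ch (g2 \<circ> g1 \<circ> H N)"
      using shift_by_commute[OF S2_comp[OF N(2,1)], of h] by (simp add: H_def o_assoc)
    finally have "?\<psi> (g1 \<circ> g2) * Z = ?\<psi> (g2 \<circ> g1) * Z"
      using key[OF S2_comp[OF N]] key[OF S2_comp[OF N(2,1)]] central[OF g] by simp
    with Z show ?thesis by (simp only: mult_cancel_right) simp
  qed
  moreover have "Im q = 0 \<and> 0 \<le> Re q"
    if g: "\<forall>i<n. g i \<in> S2inf" and q: "q = (\<Sum>i<n. \<Sum>j<n. cnj (c i) * ?\<psi> (g i \<circ> inv (g j)) * c j)"
    for n :: nat and g c q
  proof -
    obtain N where N: "\<forall>i\<in>{..<n}. \<forall>m\<ge>N. g i \<in> S2 m"
      using S2inf_common[of "{..<n}" g] g by auto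
    then have gN: "g i \<in> S2 N" if "i < n" for i using that by simp
    \<comment> \<open>The test vectors are \<open>g i\<close> multiplied by 1 + e H. Since H
      commutes with every \<open>g i\<close> and (1 + e H) squared is 2 (1 + e H), the form of
      \<open>ch\<close> at them is \<open>2 * Z * q\<close>.\<close>
    define G where "G p = g (fst p) \<circ> (if snd p then H N else id)" for p
    define C where "C p = c (fst p) * (if snd p then of_real e else 1)" for p
    have "(\<Sum>p\<in>{..<n} \<times> UNIV. \<Sum>r\<in>{..<n} \<times> UNIV. cnj (C p) * ch (G p \<circ> inv (G r)) * C r)
      = (\<Sum>i<n. \<Sum>b\<in>UNIV. \<Sum>j<n. \<Sum>b'\<in>UNIV. cnj (C (i, b)) * ch (G (i, b) \<circ> inv (G (j, b'))) * C (j, b'))"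
      unfolding sum.cartesian_product' ..
    also have "\<dots> = (\<Sum>i<n. \<Sum>j<n. \<Sum>b\<in>UNIV. \<Sum>b'\<in>UNIV. cnj (C (i, b)) * ch (G (i, b) \<circ> inv (G (j, b'))) * C (j, b'))"
      by (rule sum.cong[OF refl]) (rule sum.swap)
    also have "\<dots> = (\<Sum>i<n. \<Sum>j<n. 2 * Z * (cnj (c i) * ?\<psi> (g i \<circ> inv (g j)) * c j))"
    proof (intro sum.cong refl)
      fix i j assume ij: "i \<in> {..<n}" "j \<in> {..<n}"
      define s where "s = g i \<circ> inv (g j)"
      have gi: "g i \<in> S2 N" "g j \<in> S2 N" "g i \<in> S2inf" "g j \<in> S2inf" using gN ij g by auto
      have s: "s \<in> S2 N" unfolding s_def by (intro S2_comp S2_inv gi)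
      have comm: "inv (g j) \<circ> H N = H N \<circ> inv (g j)"
        unfolding H_def by (rule shift_by_commute[OF S2_inv[OF gi(2)]])
      have G4: "G (i, b) \<circ> inv (G (j, b')) = (if b = b' then s else s \<circ> H N)" for b b'
      proof -
        have i1: "inv (G (j, b')) = (if b' then H N \<circ> inv (g j) else inv (g j))"
          using gi H by (simp add: G_def inv_comp Hinv)
        have "g i \<circ> H N \<circ> (H N \<circ> inv (g j)) = g i \<circ> (H N \<circ> H N) \<circ> inv (g j)" by (simp only: o_assoc)
        then have "g i \<circ> H N \<circ> (H N \<circ> inv (g j)) = s" by (simp add: H(2) s_def)
        moreover have "g i \<circ> H N \<circ> inv (g j) = s \<circ> H N" "g i \<circ> (H N \<circ> inv (g j)) = s \<circ> H N"
          unfolding s_def by (simp_all only: o_assoc[symmetric] comm)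
        ultimately show ?thesis unfolding i1 by (auto simp: G_def s_def)
      qed
      have ee: "complex_of_real e * complex_of_real e = 1" using e by (metis of_real_mult of_real_1)
      have "(\<Sum>b\<in>UNIV. \<Sum>b'\<in>UNIV. cnj (C (i, b)) * ch (G (i, b) \<circ> inv (G (j, b'))) * C (j, b'))
        = cnj (c i) * c j * (2 * (ch s + of_real e * ch (s \<circ> H N)) + (complex_of_real e * complex_of_real e - 1) * ch s)"
        unfolding G4 by (simp add: UNIV_bool C_def algebra_simps)
      also have "\<dots> = 2 * Z * (cnj (c i) * ?\<psi> s * c j)"
        unfolding ee key[OF s, symmetric] by (simp add: mult_ac)
      finally show "(\<Sum>b\<in>UNIV. \<Sum>b'\<in>UNIV. cnj (C (i, b)) * ch (G (i, b) \<circ> inv (G (j, b'))) * C (j, b'))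
        = 2 * Z * (cnj (c i) * ?\<psi> (g i \<circ> inv (g j)) * c j)" unfolding s_def .
    qed
    also have "\<dots> = 2 * Z * q" unfolding q by (simp only: sum_distrib_left)
    finally have eq: "(\<Sum>p\<in>{..<n} \<times> UNIV. \<Sum>r\<in>{..<n} \<times> UNIV. cnj (C p) * ch (G p \<circ> inv (G r)) * C r) = 2 * Z * q" .
    have GS: "G p \<in> S2inf" if "p \<in> {..<n} \<times> UNIV" for p
      using that g H by (auto simp: G_def)
    have "Im (2 * Z * q) = 0" "0 \<le> Re (2 * Z * q)"
      using pos_def[of "{..<n} \<times> UNIV" G C, OF _ GS] unfolding eq by auto
    then have "2 * (1 + e * profile (fixm h)) * Im q = 0" "0 \<le> 2 * (1 + e * profile (fixm h)) * Re q"
      by (simp_all add: Z_def)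
    with pos show ?thesis by (simp add: zero_le_mult_iff)
  qed
  moreover have "?\<psi> id = 1" using pos by simp
  ultimately show ?thesis
    unfolding is_character_def Let_def by blast
qed

text \<open>The twisted characters for \<open>e = 1\<close> and \<open>e = -1\<close> recombine to
  \<open>ch\<close>, so indecomposability makes them agree at \<open>g\<close>; clearing
  denominators is the product formula. If \<open>profile u = 1\<close> the second one would have
  denominator zero, and a norm estimate replaces the splitting.\<close>

lemma profile_multiplicative:
  assumes ind: "is_indecomposable_character ch" and x: "x \<in> dyadics" and u: "u \<in> dyadics"
  shows "profile (x * u) = profile x * profile u"
proof -
  obtain h where h: "h \<in> S2inf" "h \<circ> h = id" and hu: "fixm h = u" using dyadic_involution[OF u] by blast
  obtain g where g: "g \<in> S2inf" and gx: "fixm g = x" using dyadic_involution[OF x] by blast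
  obtain N where N: "g \<in> S2 N" using g unfolding S2inf_def by blast
  define H where "H = shift_by N h"
  have H: "H \<in> S2inf" "H \<circ> H = id"
    using h shift_by_S2inf by (auto simp: H_def shift_by_comp shift_by_id)
  have Hinv: "inv H = H" by (rule involution_inv[OF H(2)])
  have chH: "ch H = of_real (profile u)"
    using char_eq_profile[OF H(1)] fixm_shift_by[OF h(1)] by (simp add: H_def hu)
  have chgH: "ch (g \<circ> H) = of_real (profile (x * u))"
    using char_eq_profile[OF S2inf_comp[OF g H(1)]] fixm_comp_shift_by[OF N h(1)] by (simp add: H_def hu gx)
  have chg: "ch g = of_real (profile x)" using char_eq_profile[OF g] by (simp add: gx)
  \<comment> \<open>The right-hand side is the squared norm of \<open>g \<circ> H\<close> minus
    \<open>g\<close> in the form of \<open>ch\<close>; it vanishes when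
    \<open>profile u = 1\<close>.\<close>
  have cs: "(cmod (ch (g \<circ> H) - ch g))\<^sup>2 \<le> 2 - 2 * profile u"
  proof -
    have "ch (g \<circ> H \<circ> inv g) = ch (inv g \<circ> (g \<circ> H))" using g H by (intro central) auto
    also have "inv g \<circ> (g \<circ> H) = H" using g by (simp add: o_assoc)
    finally have c1: "ch (g \<circ> H \<circ> inv g) = ch H" .
    have c2: "g \<circ> inv (g \<circ> H) = g \<circ> H \<circ> inv g" using g H by (simp add: inv_comp Hinv o_assoc)
    have c3: "(g \<circ> H) \<circ> inv (g \<circ> H) = id" "g \<circ> inv g = id" using g H by simp_all
    show ?thesis
      using cauchy_schwarz[of "{False, True}" "\<lambda>b. if b then g \<circ> H else g" "\<lambda>b. if b then 1 else -1"] g H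
      by (simp add: c1 c2 c3 chH del: o_apply)
  qed
  have "profile u \<le> 1"
    using order_trans[OF zero_le_power2 cs] by simp
  have "0 \<le> profile u" by (rule profile_nonneg[OF u])
  show ?thesis
  proof (cases "profile u = 1")
    case True
    with cs have "ch (g \<circ> H) = ch g" by simp
    with True show ?thesis unfolding chg chgH by simp
  next
    case False
    with \<open>profile u \<le> 1\<close> have lt: "profile u < 1" by simp
    define \<psi> where "\<psi> e g = complex_of_real ((profile (fixm g) + e * profile (fixm g * u)) / (1 + e * profile u))" for e g
    have 1: "is_character (\<psi> 1)" unfolding \<psi>_def hu[symmetric]
      by (rule twisted_character[OF h]) (use \<open>0 \<le> profile u\<close> hu in auto)
    have 2: "is_character (\<psi> (-1))" unfolding \<psi>_def hu[symmetric]
      by (rule twisted_character[OF h]) (use lt hu in auto)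
    \<comment> \<open>The weight is the value of \<open>ch\<close> at the projection (1 + H) /
      2.\<close>
    define a where "a = (1 + profile u) / 2"
    have a: "0 < a" "a < 1" using \<open>0 \<le> profile u\<close> lt by (auto simp: a_def)
    have ap: "a * (p / (1 + profile u)) = p / 2" "(1 - a) * (p / (1 - profile u)) = p / 2" for p
      using \<open>0 \<le> profile u\<close> lt by (simp_all add: a_def field_simps)
    have "ch s = of_real a * \<psi> 1 s + of_real (1 - a) * \<psi> (-1) s" if "s \<in> S2inf" for s
    proof -
      have "profile (fixm s) = a * ((profile (fixm s) + profile (fixm s * u)) / (1 + profile u)) + (1 - a) * ((profile (fixm s) - profile (fixm s * u)) / (1 - profile u))"
        unfolding ap by (simp add: field_simps)
      then show ?thesis unfolding char_eq_profile[OF that] \<psi>_def of_real_mult[symmetric] of_real_add[symmetric] by simp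
    qed
    then have "\<psi> 1 g = \<psi> (-1) g"
      using ind 1 2 a g unfolding is_indecomposable_character_def by blast
    then have "(profile x + profile (x * u)) / (1 + profile u) = (profile x - profile (x * u)) / (1 - profile u)"
      unfolding \<psi>_def gx of_real_eq_iff by simp
    then have "(profile x + profile (x * u)) * (1 - profile u) = (profile x - profile (x * u)) * (1 + profile u)"
      using \<open>0 \<le> profile u\<close> lt by (simp add: frac_eq_eq)
    then show ?thesis by (simp add: algebra_simps)
  qed
qed

lemma indecomposable_power_law:
  assumes "is_indecomposable_character ch"
  shows "\<exists>\<alpha>. \<forall>s\<in>S2inf. ch s = of_real (epow (fixm s) \<alpha>)"
proof -
  interpret multiplicative_profile profile
    by unfold_locales (auto intro: profile_multiplicative[OF assms] nabla_profile_nonneg)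
  obtain \<alpha> where "\<forall>x\<in>dyadics. profile x = epow x \<alpha>" using power_law by blast
  then show ?thesis using char_eq_profile fixm_dyadic by (intro exI[of _ \<alpha>]) simp
qed

end

section \<open>Powers of the fixed point measure are characters\<close>

lemma epow_1 [simp]: "epow 1 \<alpha> = 1"
  by (cases \<alpha>) (auto simp: epow_def)

lemma epow_bounds: "0 \<le> x \<Longrightarrow> x \<le> 1 \<Longrightarrow> 0 \<le> epow x \<alpha> \<and> epow x \<alpha> \<le> 1"
  by (cases \<alpha>) (auto simp: epow_def power_le_one)

lemma epow_mult:
  assumes "0 \<le> x" "x \<le> 1" "0 \<le> y" "y \<le> 1"
  shows "epow (x * y) \<alpha> = epow x \<alpha> * epow y \<alpha>"
proof (cases \<alpha>)
  case (enat k)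
  then show ?thesis by (simp add: epow_def power_mult_distrib)
next
  case infinity
  have "x * y = 1 \<longleftrightarrow> x = 1 \<and> y = 1"
    using assms by (smt (verit) mult_left_le mult_cancel_left1)
  then show ?thesis using infinity by (simp add: epow_def)
qed

lemma epow_infinity_limit: "0 \<le> x \<Longrightarrow> x \<le> 1 \<Longrightarrow> (\<lambda>k. x ^ k) \<longlonglongrightarrow> epow x \<infinity>"
  by (cases "x = 1") (auto simp: epow_def intro: LIMSEQ_power_zero)

text \<open>\<open>h\<close> carries the fixed points of \<open>g \<circ> h\<close> onto those of
  \<open>h \<circ> g\<close>, with \<open>g\<close> as inverse.\<close>

lemma fixm_central: assumes "g \<in> S2inf" "h \<in> S2inf" shows "fixm (g \<circ> h) = fixm (h \<circ> g)"
proof -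
  obtain n1 n2 where "\<forall>m\<ge>n1. g \<in> S2 m" "\<forall>m\<ge>n2. h \<in> S2 m"
    using assms S2inf_level by presburger
  then obtain N where N: "g \<in> S2 N" "h \<in> S2 N" by (meson max.cobounded1 max.cobounded2)
  have "bij_betw h (Fix (g \<circ> h) \<inter> words N) (Fix (h \<circ> g) \<inter> words N)"
    by (rule bij_betw_byWitness[where f' = g]) (auto simp: Fix_def S2_maps_words[OF N(1)] S2_maps_words[OF N(2)])
  then show ?thesis
    using bij_betw_same_card by (simp add: fixm_eq[OF S2_comp[OF N]] fixm_eq[OF S2_comp[OF N(2,1)]])
qed

text \<open>Schur product argument: the fixed measures form a Gram matrix of real vectors, so
  raising the exponent by one turns the form into a sum of forms of the previous exponent with
  rescaled coefficients. Hence the induction runs over all \<open>c\<close>.\<close>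

lemma fixm_power_psd:
  fixes g :: "nat \<Rightarrow> seq \<Rightarrow> seq" and c :: "nat \<Rightarrow> complex"
  assumes g: "\<And>i. i < n \<Longrightarrow> g i \<in> S2inf"
  defines "q \<equiv> \<lambda>k c. \<Sum>i<n. \<Sum>j<n. cnj (c i) * of_real (fixm (g i \<circ> inv (g j)) ^ k) * c j"
  shows "Im (q k c) = 0 \<and> 0 \<le> Re (q k c)"
proof -
  obtain N where N: "\<forall>i\<in>{..<n}. \<forall>m\<ge>N. g i \<in> S2 m"
    using S2inf_common[of "{..<n}" g] g by auto
  then have gN: "g i \<in> S2 N" if "i < n" for i using that by simp
  \<comment> \<open>The entries of the permutation matrix of \<open>inv (g i)\<close>; two such rows
    agree at \<open>x\<close> exactly when \<open>g i \<circ> inv (g j)\<close> fixes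
    \<open>x\<close>.\<close>
  define v :: "nat \<Rightarrow> seq \<Rightarrow> seq \<Rightarrow> real" where "v i x y = (if inv (g i) x = y then 1 else 0)" for i x y
  have gram: "fixm (g i \<circ> inv (g j)) = (\<Sum>x\<in>words N. \<Sum>y\<in>words N. v i x y * v j x y) / 2 ^ N" if ij: "i < n" "j < n" for i j
  proof -
    have "(\<Sum>y\<in>words N. v i x y * v j x y) = (if g i (inv (g j) x) = x then 1 else 0)" if "x \<in> words N" for x
    proof -
      have "(\<Sum>y\<in>words N. v i x y * v j x y) = (\<Sum>y\<in>words N. if inv (g i) x = y then v j x y else 0)"
        by (intro sum.cong) (auto simp: v_def)
      also have "\<dots> = v j x (inv (g i) x)"
        using S2_maps_words[OF S2_inv[OF gN[OF ij(1)]] that] by simp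
      also have "\<dots> = (if g i (inv (g j) x) = x then 1 else 0)"
        using S2inf_inv_apply[OF g[OF ij(1)]] unfolding v_def by metis
      finally show ?thesis .
    qed
    then have "(\<Sum>x\<in>words N. \<Sum>y\<in>words N. v i x y * v j x y) = (\<Sum>x\<in>words N. if g i (inv (g j) x) = x then 1 else 0)"
      by simp
    also have "\<dots> = card (Fix (g i \<circ> inv (g j)) \<inter> words N)"
      by (simp add: sum.If_cases Fix_def Int_commute)
    finally show ?thesis
      using fixm_eq[OF S2_comp[OF gN[OF ij(1)] S2_inv[OF gN[OF ij(2)]]]] by simp
  qed
  show ?thesis
  proof (induction k arbitrary: c)
    case 0
    have "q 0 c = (\<Sum>i<n. cnj (c i)) * (\<Sum>j<n. c j)"
      unfolding q_def by (simp add: sum_product)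
    also have "\<dots> = cnj (\<Sum>j<n. c j) * (\<Sum>j<n. c j)" by simp
    finally show ?case by (simp add: complex_norm_square[symmetric] mult.commute[of "cnj _"] del: cnj_sum)
  next
    case (Suc k)
    have "q (Suc k) c = (\<Sum>i<n. \<Sum>j<n. \<Sum>x\<in>words N. \<Sum>y\<in>words N.
        (cnj (c i * of_real (v i x y)) * of_real (fixm (g i \<circ> inv (g j)) ^ k) * (c j * of_real (v j x y))) / 2 ^ N)"
      unfolding q_def
    proof (intro sum.cong refl)
      fix i j assume ij: "i \<in> {..<n}" "j \<in> {..<n}"
      have "cnj (c i) * of_real (fixm (g i \<circ> inv (g j)) ^ Suc k) * c j
        = cnj (c i) * of_real (fixm (g i \<circ> inv (g j)) ^ k) * c j * of_real (\<Sum>x\<in>words N. \<Sum>y\<in>words N. v i x y * v j x y) / 2 ^ N"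
        using gram ij by simp
      also have "\<dots> = (\<Sum>x\<in>words N. \<Sum>y\<in>words N.
        (cnj (c i * of_real (v i x y)) * of_real (fixm (g i \<circ> inv (g j)) ^ k) * (c j * of_real (v j x y))) / 2 ^ N)"
        by (simp add: sum_distrib_left sum_divide_distrib mult_ac)
      finally show "cnj (c i) * of_real (fixm (g i \<circ> inv (g j)) ^ Suc k) * c j = (\<Sum>x\<in>words N. \<Sum>y\<in>words N.
        (cnj (c i * of_real (v i x y)) * of_real (fixm (g i \<circ> inv (g j)) ^ k) * (c j * of_real (v j x y))) / 2 ^ N)" .
    qed
    also have "\<dots> = (\<Sum>x\<in>words N. \<Sum>y\<in>words N. \<Sum>i<n. \<Sum>j<n.
        (cnj (c i * of_real (v i x y)) * of_real (fixm (g i \<circ> inv (g j)) ^ k) * (c j * of_real (v j x y))) / 2 ^ N)"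
      by (simp only: sum.swap[where A = "{..<n}" and B = "words N"])
    also have "\<dots> = (\<Sum>x\<in>words N. \<Sum>y\<in>words N. q k (\<lambda>i. c i * of_real (v i x y)) / 2 ^ N)"
      unfolding q_def by (simp only: sum_divide_distrib)
    finally have eq: "q (Suc k) c = (\<Sum>x\<in>words N. \<Sum>y\<in>words N. q k (\<lambda>i. c i * of_real (v i x y)) / of_real (2 ^ N))" by simp
    show ?case unfolding eq Re_sum Im_sum Re_divide_of_real Im_divide_of_real using Suc.IH by (auto intro!: sum_nonneg sum.neutral divide_nonneg_nonneg)
  qed
qed

text \<open>The infinite exponent is the pointwise limit of finite ones, and the conditions on the
  form are closed under limits.\<close>

lemma epow_character: "is_character (\<lambda>s. of_real (epow (fixm s) \<alpha>))"
proof -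
  have "Im q = 0 \<and> 0 \<le> Re q"
    if g: "\<forall>i<n. g i \<in> S2inf" and q: "q = (\<Sum>i<n. \<Sum>j<n. cnj (c i) * of_real (epow (fixm (g i \<circ> inv (g j))) \<alpha>) * c j)"
    for n :: nat and g c q
  proof (cases \<alpha>)
    case (enat k)
    then show ?thesis unfolding q using fixm_power_psd[of n g c k] g by (simp add: epow_def)
  next
    case infinity
    define qk where "qk k = (\<Sum>i<n. \<Sum>j<n. cnj (c i) * of_real (fixm (g i \<circ> inv (g j)) ^ k) * c j)" for k
    have lim: "qk \<longlonglongrightarrow> q"
      unfolding qk_def q infinity
      by (intro tendsto_sum tendsto_mult tendsto_const tendsto_of_real epow_infinity_limit fixm_bounds)
    have pk: "Im (qk k) = 0" "0 \<le> Re (qk k)" for k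
      unfolding qk_def using fixm_power_psd[of n g c k] g by auto
    have "(\<lambda>k. Im (qk k)) \<longlonglongrightarrow> Im q" "(\<lambda>k. Re (qk k)) \<longlonglongrightarrow> Re q"
      using lim by (auto intro: tendsto_intros)
    then show ?thesis using pk LIMSEQ_unique[of "\<lambda>_. 0" "Im q" 0] LIMSEQ_le_const[of "\<lambda>k. Re (qk k)" "Re q" 0] by auto
  qed
  then show ?thesis
    unfolding is_character_def Let_def using fixm_central by auto
qed

section \<open>Extremality of the powers\<close>

lemma is_character_cong:
  assumes "is_character \<psi>" and eq: "\<And>g. g \<in> S2inf \<Longrightarrow> ch g = \<psi> g"
  shows "is_character ch"
proof -
  have "(\<Sum>i<n. \<Sum>j<n. cnj (c i) * ch (g i \<circ> inv (g j)) * c j) = (\<Sum>i<n. \<Sum>j<n. cnj (c i) * \<psi> (g i \<circ> inv (g j)) * c j)"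
    if "\<forall>i<n. g i \<in> S2inf" for n :: nat and g c
    using that by (intro sum.cong refl) (simp add: eq)
  with assms show ?thesis unfolding is_character_def Let_def by auto
qed

text \<open>For far copies \<open>h\<^sub>k\<close> of \<open>h\<close>, the vector \<open>\<Sum>k<L. (h\<^sub>k - r)\<close> has squared norm at most \<open>L\<close> in the
  whole character, hence at most \<open>L / a\<close> in the component.\<close>

lemma (in character) component_eq:
  assumes a: "0 < a" "a < 1" and ch2: "is_character ch2"
    and dec: "\<And>s. s \<in> S2inf \<Longrightarrow> of_real (epow (fixm s) \<alpha>) = of_real a * ch s + of_real (1 - a) * ch2 s"
    and h: "h \<in> S2inf"
  shows "ch h = of_real (epow (fixm h) \<alpha>)"
proof -
  interpret ch2: character ch2 by unfold_locales (rule ch2)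
  obtain n where n: "h \<in> S2 n" using h unfolding S2inf_def by blast
  define r where "r = epow (fixm h) \<alpha>"
  have r: "0 \<le> r" "r \<le> 1" using epow_bounds[OF fixm_bounds] by (auto simp: r_def)
  \<comment> \<open>Consecutive copies act on disjoint blocks of \<open>n\<close> coordinates, so an
    earlier copy lies in \<open>S2 (l * n)\<close> and fixed measures of quotients multiply.\<close>
  define hk where "hk k = shift_by (k * n) h" for k
  have hk: "hk k \<in> S2inf" for k unfolding hk_def by (rule shift_by_S2inf[OF h])
  have hk2: "hk k \<in> S2 (l * n)" if "k < l" for k l
  proof (rule S2_mono)
    show "hk k \<in> S2 (k * n + n)" unfolding hk_def by (rule shift_by_S2[OF n])
    show "k * n + n \<le> l * n" using mult_le_mono1[of "Suc k" l n] that by simp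
  qed
  have fhk: "fixm (hk k) = fixm h" for k unfolding hk_def by (rule fixm_shift_by[OF h])
  have lt: "fixm (hk k \<circ> inv (hk l)) = fixm h * fixm h" if "k < l" for k l
    using fixm_comp_shift_by[OF hk2[OF that] S2inf_inv[OF h]] shift_by_inv[OF h] fhk[of k] fixm_inv[OF h]
    by (simp add: hk_def)
  have ne: "fixm (hk k \<circ> inv (hk l)) = fixm h * fixm h" if "k \<noteq> l" for k l
  proof (cases "k < l")
    case False
    with that have "l < k" by simp
    have "inv (hk l \<circ> inv (hk k)) = hk k \<circ> inv (hk l)" using hk by (simp add: inv_comp)
    then show ?thesis using lt[OF \<open>l < k\<close>] fixm_inv[of "hk l \<circ> inv (hk k)"] hk by simp
  qed (rule lt)
  have bound: "a * (real L * (cmod (ch h - of_real r))\<^sup>2) \<le> 1" if "0 < L" for L :: nat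
  proof -
    define g where "g i = (if i < L then hk i else id)" for i
    \<comment> \<open>Index \<open>L\<close> carries \<open>id\<close>, whose coefficient collects
      the subtracted constant \<open>r\<close> from all \<open>L\<close> copies.\<close>
    define c :: "nat \<Rightarrow> complex" where "c i = (if i < L then 1 else - (of_nat L * of_real r))" for i
    define Q where "Q \<psi> = (\<Sum>i<Suc L. \<Sum>j<Suc L. cnj (c i) * \<psi> (g i \<circ> inv (g j)) * c j)"
      for \<psi> :: "(seq \<Rightarrow> seq) \<Rightarrow> complex"
    have g: "g i \<in> S2inf" for i using hk by (simp add: g_def)
    define \<psi> where "\<psi> s = complex_of_real (epow (fixm s) \<alpha>)" for s
    have \<psi>1: "\<psi> (hk i) = of_real r" "\<psi> (inv (hk i)) = of_real r" for i
      using fhk[of i] fixm_inv[OF hk] by (simp_all add: \<psi>_def r_def)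
    \<comment> \<open>In the form of \<open>\<psi>\<close> the vectors of the copies minus
      \<open>r\<close> are therefore pairwise orthogonal, each of squared norm
      \<open>1 - r * r\<close>.\<close>
    have \<psi>2: "\<psi> (hk i \<circ> inv (hk j)) = of_real (r * r) + (if i = j then of_real (1 - r * r) else 0)" for i j
      using ne[of i j] hk epow_mult[OF fixm_bounds fixm_bounds, of h h \<alpha>] by (simp add: \<psi>_def r_def)
    have "Q \<psi> = of_real (real L * (1 - r * r))"
    proof -
      define inner where "inner i = (\<Sum>j<Suc L. cnj (c i) * \<psi> (g i \<circ> inv (g j)) * c j)" for i
      have i1: "inner i = of_real (1 - r * r)" if "i < L" for i
      proof -
        have "inner i = (\<Sum>j<L. \<psi> (hk i \<circ> inv (hk j))) - of_nat L * of_real (r * r)"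
          unfolding inner_def using that by (simp add: c_def g_def \<psi>1 sum.lessThan_Suc)
        also have "\<dots> = of_real (1 - r * r)"
          using that by (simp add: \<psi>2 sum.distrib)
        finally show ?thesis .
      qed
      have i2: "inner L = 0"
        unfolding inner_def by (simp add: c_def g_def \<psi>1 sum.lessThan_Suc) (simp add: \<psi>_def)
      have "Q \<psi> = (\<Sum>i<Suc L. inner i)" unfolding Q_def inner_def ..
      with i1 i2 show ?thesis by simp
    qed
    moreover have "Q \<psi> = of_real a * Q ch + of_real (1 - a) * Q ch2"
    proof -
      have "Q \<psi> = (\<Sum>i<Suc L. \<Sum>j<Suc L. of_real a * (cnj (c i) * ch (g i \<circ> inv (g j)) * c j)
        + of_real (1 - a) * (cnj (c i) * ch2 (g i \<circ> inv (g j)) * c j))"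
        unfolding Q_def
      proof (intro sum.cong refl)
        fix i j
        have "\<psi> (g i \<circ> inv (g j)) = of_real a * ch (g i \<circ> inv (g j)) + of_real (1 - a) * ch2 (g i \<circ> inv (g j))"
          unfolding \<psi>_def using g by (intro dec) simp
        then show "cnj (c i) * \<psi> (g i \<circ> inv (g j)) * c j = of_real a * (cnj (c i) * ch (g i \<circ> inv (g j)) * c j)
          + of_real (1 - a) * (cnj (c i) * ch2 (g i \<circ> inv (g j)) * c j)"
          by (simp only: distrib_left distrib_right mult_ac)
      qed
      then show ?thesis unfolding Q_def by (simp only: sum.distrib sum_distrib_left)
    qed
    ultimately have "real L * (1 - r * r) = a * Re (Q ch) + (1 - a) * Re (Q ch2)"
      by (metis Re_complex_of_real plus_complex.sel(1) Re_complex_of_real times_complex.sel(1) Im_complex_of_real mult_zero_left diff_zero)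
    moreover have "0 \<le> Re (Q ch2)" unfolding Q_def by (rule ch2.pos_def(2)) (auto simp: g)
    ultimately have "a * Re (Q ch) \<le> real L * (1 - r * r)" using a by simp
    also have "\<dots> \<le> real L" using r by (simp add: mult_left_le)
    finally have aQ: "a * Re (Q ch) \<le> real L" .
    have "(\<Sum>i<Suc L. cnj (c i) * ch (g i)) = of_nat L * (ch h - of_real r)"
    proof -
      have "ch (hk i) = ch h" for i by (rule char_fixm_cong[OF hk h fhk])
      then show ?thesis by (simp add: c_def g_def sum.lessThan_Suc algebra_simps)
    qed
    then have "(cmod (of_nat L * (ch h - of_real r)))\<^sup>2 \<le> Re (Q ch)"
      using cauchy_schwarz[of "{..<Suc L}" g c] g unfolding Q_def by simp
    then have "a * (real L * (real L * (cmod (ch h - of_real r))\<^sup>2)) \<le> a * Re (Q ch)"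
      using a by (simp add: norm_mult power_mult_distrib power2_eq_square mult_ac)
    with aQ have "real L * (a * (real L * (cmod (ch h - of_real r))\<^sup>2)) \<le> real L * 1"
      by (simp add: mult_ac)
    with that show ?thesis by simp
  qed
  have "cmod (ch h - of_real r) = 0"
  proof (rule ccontr)
    assume "cmod (ch h - of_real r) \<noteq> 0"
    with a have "0 < a * (cmod (ch h - of_real r))\<^sup>2" by simp
    then obtain L :: nat where L: "1 < real L * (a * (cmod (ch h - of_real r))\<^sup>2)"
      using reals_Archimedean3 by blast
    then have "0 < L" by (cases L) auto
    from bound[OF this] L show False by (simp add: mult_ac)
  qed
  then show ?thesis by (simp add: r_def)
qed

text \<open>\<open>component_eq\<close> applies to either component, with weights \<open>a\<close>
  and \<open>1 - a\<close>, and identifies both with the same power.\<close>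

lemma epow_indecomposable:
  assumes eq: "\<And>s. s \<in> S2inf \<Longrightarrow> ch s = complex_of_real (epow (fixm s) \<alpha>)"
  shows "is_indecomposable_character ch"
  unfolding is_indecomposable_character_def
proof (intro conjI notI)
  show "is_character ch" by (rule is_character_cong[OF epow_character eq])
  assume "\<exists>a chi1 chi2. 0 < a \<and> a < 1 \<and> is_character chi1 \<and> is_character chi2 \<and>
    (\<exists>g\<in>S2inf. chi1 g \<noteq> chi2 g) \<and> (\<forall>g\<in>S2inf. ch g = of_real a * chi1 g + of_real (1 - a) * chi2 g)"
  then obtain a chi1 chi2 g where a: "0 < a" "a < 1" and c: "is_character chi1" "is_character chi2"
    and g: "g \<in> S2inf" "chi1 g \<noteq> chi2 g"
    and dec: "\<And>g. g \<in> S2inf \<Longrightarrow> ch g = of_real a * chi1 g + of_real (1 - a) * chi2 g" by blast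
  interpret c1: character chi1 by unfold_locales (rule c)
  interpret c2: character chi2 by unfold_locales (rule c)
  have "chi1 g = of_real (epow (fixm g) \<alpha>)"
    by (rule c1.component_eq[OF a c(2) _ g(1)]) (simp add: eq[symmetric] dec)
  moreover have "chi2 g = of_real (epow (fixm g) \<alpha>)"
    by (rule c2.component_eq[of "1 - a", OF _ _ c(1) _ g(1)]) (use a in \<open>auto simp: eq[symmetric] dec\<close>)
  ultimately show False using g by simp
qed

theorem mainTheorem1:
  fixes chi :: "((nat \<Rightarrow> bool) \<Rightarrow> (nat \<Rightarrow> bool)) \<Rightarrow> complex"
  shows "is_indecomposable_character chi \<longleftrightarrow>
    (\<exists>\<alpha>::enat. \<forall>s\<in>S2inf. chi s = complex_of_real (epow (measure mu (Fix s)) \<alpha>))"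
proof
  assume ind: "is_indecomposable_character chi"
  then interpret character chi
    by unfold_locales (simp add: is_indecomposable_character_def)
  show "\<exists>\<alpha>. \<forall>s\<in>S2inf. chi s = complex_of_real (epow (measure mu (Fix s)) \<alpha>)"
    using indecomposable_power_law[OF ind] unfolding fixm_def .
next
  assume "\<exists>\<alpha>. \<forall>s\<in>S2inf. chi s = complex_of_real (epow (measure mu (Fix s)) \<alpha>)"
  then show "is_indecomposable_character chi"
    using epow_indecomposable unfolding fixm_def by blast
qed

end
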